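(* Let $N$ be the Iwasawa manifold with its standard left-invariant metric and fix $\alpha>0$. The set of invariant mixed structures $(J,V)\in\mathcal{F}^+$ on $N$ of class $\mathcal{W}_{34}\cap\mathcal{V}_{15}$ (i.e. $J$ is of class $\mathcal{W}_{34}$ and the almost product structure defined by $V$ is of class $\mathcal{V}_{15}$) is diffeomorphic to the disjoint union $(\mathbb{CP}^1\times\mathbb{CP}^1)\sqcup\mathbb{CP}^1$. Its image under $\mu_T$ is the union of the filled rectangle with vertices $(1+\alpha,-1,-1)$, $(1,-1-\alpha,-1)$, $(-1-\alpha,1,-1)$, $(-1,1+\alpha,-1)$ (the image of $\mathbb{CP}^1\times\mathbb{CP}^1$) and the line segment joining $(1+\alpha,1,1)$ to $(1,1+\alpha,1)$ (the image of $\mathbb{CP}^1$).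
   Context: The Iwasawa manifold. $G_H$ is the complex Heisenberg group of matrices $\begin{pmatrix}1&z^1&z^3\\0&1&z^2\\0&0&1\end{pmatrix}$, $z^k\in\mathbb{C}$; $\Gamma\subset G_H$ is the subgroup with entries in $\mathbb{Z}[i]$; $N=\Gamma\backslash G_H$. Left-invariant real 1-forms $e^1,\dots,e^6$ are defined by $e^1+ie^2=dz^1$, $e^3+ie^4=dz^2$, $e^5+ie^6=-dz^3+z^1dz^2$; they descend to $N$. The metric $g$ on $N$ is the one for which $e^1,\dots,e^6$ are orthonormal, and the orientation is $e^1\wedge\dots\wedge e^6$. All structures are invariant, i.e. have constant coefficients in this frame, so they are identified with structures on $\mathbb{R}^6$ with orthonormal basis $e^1,\dots,e^6$ (tangent and cotangent vectors are identified by $g$). Write $e^{ij}=e^i\wedge e^j$. OCS, OPS, MS. An OCS is an orthogonal $J$ with $J^2=-1$, with 2-form $\omega_J(X,Y)=g(JX,Y)$; $\mathcal{P}^+$ is the set of OCS's inducing the given orientation. $\mathcal{G}=\mathrm{Gr}_2(\mathbb{R}^6)$ is the set of oriented 2-planes $V$; each defines an orthogonal almost product structure (OPS) $TN=\mathcal{V}\oplus\mathcal{H}$ with $\mathcal{V}=V$ and $\mathcal{H}=V^\perp$. If $V$ is $J$-invariant, it is oriented consistently with $J$ if $(v,Jv)$ is a positive basis for $0\neq v\in V$. $\mathcal{F}^+$ is the set of mixed structures (MS's) $(J,V)$ with $J\in\mathcal{P}^+$ and $V\in\mathcal{G}$ a $J$-invariant 2-plane oriented consistently with $J$. For $\alpha>0$,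 $\mathcal{F}^+$ is identified with the $SO(6)$-orbit of $(1+\alpha)e^{12}+e^{34}+e^{56}$ in $\Lambda^2\mathbb{R}^6\cong\mathfrak{so}(6)^*$ by $(J,V)\mapsto\omega_J+\alpha\,v\wedge Jv$, $v\in V$ a unit vector. The map $\mu_T:\mathcal{F}^+\to\mathbb{R}^3$ sends a 2-form to its coefficients along $e^{12},e^{34},e^{56}$ (it is the moment map of the maximal torus of $SO(6)$ of rotations in the planes $\langle e^1,e^2\rangle,\langle e^3,e^4\rangle,\langle e^5,e^6\rangle$). Torsion classes. $J$ is of class $\mathcal{W}_{34}$ (the Gray–Hervella class $\mathcal{W}_3\oplus\mathcal{W}_4$) if it is integrable (its Nijenhuis tensor vanishes). For an OPS with Levi-Civita connection $\nabla$, the intrinsic torsion consists of the tensors $A(v,v',h)=g(\nabla_vv',h)$ and $B(h,h',v)=g(\nabla_hh',v)$ ($v,v'$ sections of $\mathcal{V}$, $h,h'$ sections of $\mathcal{H}$). Their components are $\mathcal{V}_1=\Lambda^2\mathcal{V}\otimes\mathcal{H}$, $\mathcal{V}_2=S^2_0\mathcal{V}\otimes\mathcal{H}$, $\mathcal{V}_3=1_{\mathcal{V}}\otimes\mathcal{H}$ (skew, tracefree symmetric, and trace part of $A$ in $(v,v')$) and $\mathcal{V}_4=\Lambda^2\mathcal{H}\otimes\mathcal{V}$, $\mathcal{V}_5=S_0^2\mathcal{H}\otimes\mathcal{V}$, $\mathcal{V}_6=1_{\mathcal{H}}\otimes\mathcal{V}$ (skew, tracefree symmetric, and trace part of $B$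 in $(h,h')$). An OPS is of class $\mathcal{V}_{ij\dots}$ if its intrinsic torsion lies in $\mathcal{V}_i\oplus\mathcal{V}_j\oplus\cdots$. *)

theory Defs
  imports "HOL-Analysis.Analysis"
begin

section \<open>Smooth maps and diffeomorphisms\<close>

primrec Ck_on :: "nat \<Rightarrow> 'a::real_normed_vector set \<Rightarrow> ('a \<Rightarrow> 'b::real_normed_vector) \<Rightarrow> bool" where
  "Ck_on 0 S f \<longleftrightarrow> continuous_on S f"
| "Ck_on (Suc n) S f \<longleftrightarrow>
     (\<forall>x\<in>S. f differentiable (at x)) \<and> (\<forall>v. Ck_on n S (\<lambda>x. frechet_derivative f (at x) v))"

text \<open>Used for open \<open>S\<close> only.\<close>

definition smooth_on :: "'a::real_normed_vector set \<Rightarrow> ('a \<Rightarrow> 'b::real_normed_vector) \<Rightarrow> bool" where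
  "smooth_on S f \<longleftrightarrow> (\<forall>n. Ck_on n S f)"

text \<open>A manifold is given by an atlas, that is, by a set of pairs of a chart domain and a
  chart map. Its topology is the one for which the charts are homeomorphisms onto open sets.\<close>

type_synonym ('m, 'e) atlas = "('m set \<times> ('m \<Rightarrow> 'e)) set"

definition points :: "('m, 'e) atlas \<Rightarrow> 'm set" where
  "points A = (\<Union>(U, \<phi>)\<in>A. U)"

definition product_atlas :: "('m, 'e) atlas \<Rightarrow> ('n, 'f) atlas \<Rightarrow> ('m \<times> 'n, 'e \<times> 'f) atlas" where
  "product_atlas A B = {(U \<times> U', map_prod \<phi> \<phi>') | U \<phi> U' \<phi>'. (U, \<phi>) \<in> A \<and> (U', \<phi>') \<in> B}"

text \<open>Diffeomorphisms from a manifold onto a subset \<open>S\<close> of a Euclidean space. A map defined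
  on \<open>S\<close> is smooth if near each point of \<open>S\<close> it extends to a smooth map on an open set of the
  ambient space; for an embedded submanifold this is smoothness in the usual sense. Conversely,
  the last condition (smoothness of the inverse of \<open>f\<close>, read in the charts) forces \<open>f\<close> to be an
  immersion and a homeomorphism onto \<open>S\<close>, so \<open>S\<close> is an embedded submanifold.\<close>

definition diffeomorphism_onto ::
  "('m, 'e::euclidean_space) atlas \<Rightarrow> ('m \<Rightarrow> 'f::euclidean_space) \<Rightarrow> 'f set \<Rightarrow> bool" where
  "diffeomorphism_onto A f S \<longleftrightarrow>
     bij_betw f (points A) S \<and>
     (\<forall>(U, \<phi>)\<in>A. smooth_on (\<phi> ` U) (f \<circ> inv_into U \<phi>)) \<and>
     (\<forall>(U, \<phi>)\<in>A. \<forall>p\<in>U. \<exists>W g. open W \<and> f p \<in> W \<and> smooth_on W g \<and>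
        (\<forall>q\<in>points A. f q \<in> W \<longrightarrow> q \<in> U \<and> \<phi> q = g (f q)))"

text \<open>Diffeomorphisms from the disjoint union of two manifolds, possibly of different
  dimensions: both pieces are open in the image, and each is mapped diffeomorphically.\<close>

definition sum_diffeomorphism_onto ::
  "('m, 'e::euclidean_space) atlas \<Rightarrow> ('n, 'e'::euclidean_space) atlas \<Rightarrow>
   ('m + 'n \<Rightarrow> 'f::euclidean_space) \<Rightarrow> 'f set \<Rightarrow> bool" where
  "sum_diffeomorphism_onto A B f S \<longleftrightarrow>
     bij_betw f (points A <+> points B) S \<and>
     openin (top_of_set S) (f ` Inl ` points A) \<and>
     openin (top_of_set S) (f ` Inr ` points B) \<and>
     diffeomorphism_onto A (f \<circ> Inl) (f ` Inl ` points A) \<and>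
     diffeomorphism_onto B (f \<circ> Inr) (f ` Inr ` points B)"

section \<open>The complex projective line\<close>

definition complex_line :: "complex^2 \<Rightarrow> (complex^2) set" where
  "complex_line v = range (\<lambda>c. c *s v)"

definition CP1 :: "(complex^2) set set" where
  "CP1 = {complex_line v | v. v \<noteq> 0}"

definition CP1_atlas :: "((complex^2) set, complex) atlas" where
  "CP1_atlas =
     {({L \<in> CP1. \<exists>w. vector [1, w] \<in> L}, \<lambda>L. THE w. vector [1, w] \<in> L),
      ({L \<in> CP1. \<exists>w. vector [w, 1] \<in> L}, \<lambda>L. THE w. vector [w, 1] \<in> L)}"

lemma points_CP1_atlas: "points CP1_atlas = CP1"
proof -
  have "(\<exists>w. vector [1, w] \<in> L) \<or> (\<exists>w. vector [w, 1] \<in> L)" if "L \<in> CP1" for L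
  proof -
    from that obtain v where v: "v \<noteq> 0" "L = complex_line v"
      by (auto simp: CP1_def)
    from v(1) have "v $ 1 \<noteq> 0 \<or> v $ 2 \<noteq> 0"
      by (auto simp: vec_eq_iff forall_2)
    then show ?thesis
    proof
      assume "v $ 1 \<noteq> 0"
      then have "vector [1, v $ 2 / v $ 1] = (1 / v $ 1) *s v"
        by (simp add: vec_eq_iff forall_2)
      then show ?thesis using v(2) unfolding complex_line_def by (metis rangeI)
    next
      assume "v $ 2 \<noteq> 0"
      then have "vector [v $ 1 / v $ 2, 1] = (1 / v $ 2) *s v"
        by (simp add: vec_eq_iff forall_2)
      then show ?thesis using v(2) unfolding complex_line_def by (metis rangeI)
    qed
  qed
  then show ?thesis
    by (auto simp: points_def CP1_atlas_def)
qed

lemma points_product_atlas: "points (product_atlas A B) = points A \<times> points B"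
  unfolding points_def product_atlas_def by fast

section \<open>The complex Heisenberg group and its left-invariant frame\<close>

text \<open>The Heisenberg group is parametrised by \<open>z = (z\<^sup>1, z\<^sup>2, z\<^sup>3)\<close>.\<close>

definition heisenberg :: "complex^3 \<Rightarrow> complex^3^3" where
  "heisenberg z = vector [vector [1, z$1, z$3], vector [0, 1, z$2], vector [0, 0, 1]]"

definition left_translation :: "complex^3 \<Rightarrow> complex^3 \<Rightarrow> complex^3" where
  "left_translation a z = vector [a$1 + z$1, a$2 + z$2, a$3 + z$3 + a$1 * z$2]"

text \<open>\<open>coframe z w\<close> is the vector of the values at the point \<open>z\<close> of the 1-forms
  \<open>e\<^sup>1, \<dots>, e\<^sup>6\<close> on the tangent vector \<open>w\<close>, where \<open>e\<^sup>1 + i e\<^sup>2 = dz\<^sup>1\<close>, \<open>e\<^sup>3 + i e\<^sup>4 = dz\<^sup>2\<close>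
  and \<open>e\<^sup>5 + i e\<^sup>6 = - dz\<^sup>3 + z\<^sup>1 dz\<^sup>2\<close>.\<close>

definition coframe :: "complex^3 \<Rightarrow> complex^3 \<Rightarrow> real^6" where
  "coframe z w = vector
     [Re (w$1), Im (w$1), Re (w$2), Im (w$2), Re (- (w$3) + z$1 * w$2), Im (- (w$3) + z$1 * w$2)]"

definition invariant_field :: "real^6 \<Rightarrow> complex^3 \<Rightarrow> complex^3" where
  "invariant_field u z = inv (coframe z) u"

definition lie_bracket ::
  "('a::real_normed_vector \<Rightarrow> 'a) \<Rightarrow> ('a \<Rightarrow> 'a) \<Rightarrow> 'a \<Rightarrow> 'a" where
  "lie_bracket X Y z = frechet_derivative Y (at z) (X z) - frechet_derivative X (at z) (Y z)"

text \<open>The bracket of two left-invariant vector fields is left-invariant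
  (\<open>lie_bracket_invariant_field\<close> below), hence determined by its coefficients at one point.\<close>

definition bracket :: "real^6 \<Rightarrow> real^6 \<Rightarrow> real^6" where
  "bracket u v = coframe 0 (lie_bracket (invariant_field u) (invariant_field v) 0)"

text \<open>The following facts justify the identification of the invariant structures on the quotient
  of the Heisenberg group by the left action of the matrices with entries in \<open>\<int>[i]\<close> with
  structures on \<open>\<real>\<^sup>6\<close>: the coframe is invariant under all left translations, and the Lie algebra
  of left-invariant fields is \<open>\<real>\<^sup>6\<close> with \<open>bracket\<close>.\<close>

lemma vector_6:
  "(vector [a, b, c, d, e, f] :: ('a::zero)^6) $ 1 = a"
  "(vector [a, b, c, d, e, f] :: ('a::zero)^6) $ 2 = b"
  "(vector [a, b, c, d, e, f] :: ('a::zero)^6) $ 3 = c"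
  "(vector [a, b, c, d, e, f] :: ('a::zero)^6) $ 4 = d"
  "(vector [a, b, c, d, e, f] :: ('a::zero)^6) $ 5 = e"
  "(vector [a, b, c, d, e, f] :: ('a::zero)^6) $ 6 = f"
  unfolding vector_def by simp_all

lemma exhaust_6:
  fixes x :: 6
  shows "x = 1 \<or> x = 2 \<or> x = 3 \<or> x = 4 \<or> x = 5 \<or> x = 6"
proof (induct x)
  case (of_int z)
  then have "z = 0 \<or> z = 1 \<or> z = 2 \<or> z = 3 \<or> z = 4 \<or> z = 5" by (auto; arith)
  then show ?case by auto
qed

lemma forall_6: "(\<forall>i::6. P i) \<longleftrightarrow> P 1 \<and> P 2 \<and> P 3 \<and> P 4 \<and> P 5 \<and> P 6"
  by (metis exhaust_6)

lemma heisenberg_mult: "heisenberg a ** heisenberg z = heisenberg (left_translation a z)"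
  by (simp add: heisenberg_def left_translation_def vec_eq_iff forall_3 matrix_matrix_mult_def
      sum_3 algebra_simps)

lemma invariant_field_eq:
  "invariant_field u z =
     vector [Complex (u$1) (u$2), Complex (u$3) (u$4),
             z$1 * Complex (u$3) (u$4) - Complex (u$5) (u$6)]"
proof -
  let ?F = "\<lambda>u. vector [Complex (u$1) (u$2), Complex (u$3) (u$4),
             z$1 * Complex (u$3) (u$4) - Complex (u$5) (u$6)] :: complex^3"
  have "coframe z (?F u) = u" for u
    by (simp add: coframe_def vec_eq_iff forall_6 vector_6)
  moreover have "?F (coframe z w) = w" for w
    by (simp add: coframe_def vec_eq_iff forall_3 vector_6 complex_eq_iff)
  ultimately have "inv (coframe z) = ?F"
    by (intro inv_equality)
  then show ?thesis
    by (simp add: invariant_field_def)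
qed

lemma coframe_invariant_field: "coframe z (invariant_field u z) = u"
  by (simp add: coframe_def invariant_field_eq vec_eq_iff forall_6 vector_6)

lemma invariant_field_coframe: "invariant_field (coframe z w) z = w"
  by (simp add: coframe_def invariant_field_eq vec_eq_iff forall_3 vector_6 complex_eq_iff)

lemma has_derivative_vector_3:
  fixes f g h :: "'a::real_normed_vector \<Rightarrow> complex"
  assumes "(f has_derivative f') F" "(g has_derivative g') F" "(h has_derivative h') F"
  shows "((\<lambda>z. vector [f z, g z, h z] :: complex^3) has_derivative
          (\<lambda>w. vector [f' w, g' w, h' w])) F"
proof -
  have eq: "(vector [a, b, c] :: complex^3) = axis 1 a + axis 2 b + axis 3 c" for a b c
    by (simp add: vec_eq_iff forall_3 axis_def)
  have ax: "bounded_linear (axis i :: complex \<Rightarrow> complex^3)" for i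
    by (rule linear_conv_bounded_linear[THEN iffD1])
      (auto intro!: linearI simp: vec_eq_iff axis_def)
  show ?thesis
    unfolding eq
    by (intro has_derivative_add bounded_linear.has_derivative[OF ax] assms)
qed

lemma coframe_left_invariant:
  "coframe (left_translation a z) (frechet_derivative (left_translation a) (at z) w) = coframe z w"
proof -
  have nth: "((\<lambda>z. z $ i) has_derivative (\<lambda>w. w $ i)) (at z)" for i :: 3 and z :: "complex^3"
    by (rule bounded_linear.has_derivative[OF bounded_linear_vec_nth has_derivative_ident])
  have "(left_translation a has_derivative
          (\<lambda>w. vector [0 + w$1, 0 + w$2, 0 + w$3 + a$1 * w$2])) (at z)"
    unfolding left_translation_def
    by (intro has_derivative_vector_3 has_derivative_add has_derivative_const nth
        has_derivative_mult_right)
  then have "frechet_derivative (left_translation a) (at z) =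
      (\<lambda>w. vector [w$1, w$2, w$3 + a$1 * w$2])"
    by (rule frechet_derivative_at[symmetric, OF has_derivative_eq_rhs]) (simp add: fun_eq_iff)
  then show ?thesis
    by (simp add: coframe_def left_translation_def algebra_simps)
qed

lemma lie_bracket_invariant_field_eq:
  "lie_bracket (invariant_field u) (invariant_field v) z =
     vector [0, 0, Complex (u$1) (u$2) * Complex (v$3) (v$4)
                 - Complex (v$1) (v$2) * Complex (u$3) (u$4)]"
proof -
  have nth: "((\<lambda>z. z $ i) has_derivative (\<lambda>w. w $ i)) (at z)" for i :: 3 and z :: "complex^3"
    by (rule bounded_linear.has_derivative[OF bounded_linear_vec_nth has_derivative_ident])
  have "(invariant_field u has_derivative
          (\<lambda>w. vector [0, 0, w$1 * Complex (u$3) (u$4) - 0])) (at z)" for u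
    unfolding invariant_field_eq
    by (intro has_derivative_vector_3 has_derivative_diff has_derivative_const nth
        has_derivative_mult_left)
  then have "frechet_derivative (invariant_field u) (at z) =
      (\<lambda>w. vector [0, 0, w$1 * Complex (u$3) (u$4)])" for u
    by (rule frechet_derivative_at[symmetric, OF has_derivative_eq_rhs]) (simp add: fun_eq_iff)
  then show ?thesis
    by (simp add: lie_bracket_def invariant_field_eq vec_eq_iff forall_3)
qed

lemma bracket_eq:
  "bracket u v = vector [0, 0, 0, 0,
     (v$1 * u$3 - v$2 * u$4) - (u$1 * v$3 - u$2 * v$4),
     (v$1 * u$4 + v$2 * u$3) - (u$1 * v$4 + u$2 * v$3)]"
  by (simp add: bracket_def lie_bracket_invariant_field_eq coframe_def vec_eq_iff forall_6 vector_6)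

lemma lie_bracket_invariant_field:
  "lie_bracket (invariant_field u) (invariant_field v) = invariant_field (bracket u v)"
  by (rule ext) (simp add: lie_bracket_invariant_field_eq bracket_eq invariant_field_eq
      vec_eq_iff forall_3 vector_6 complex_eq_iff algebra_simps)

section \<open>Levi-Civita connection and torsion classes\<close>

text \<open>The Levi-Civita connection on left-invariant fields, for the metric in which the frame is
  orthonormal. For such fields the functions \<open>g(Y, Z)\<close> are constant, so that metric compatibility
  becomes skew-symmetry.\<close>

definition levi_civita :: "(real^6 \<Rightarrow> real^6 \<Rightarrow> real^6) \<Rightarrow> bool" where
  "levi_civita D \<longleftrightarrow> bilinear D \<and>
     (\<forall>x y z. D x y \<bullet> z + y \<bullet> D x z = 0) \<and>
     (\<forall>x y. D x y - D y x = bracket x y)"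

definition nabla :: "real^6 \<Rightarrow> real^6 \<Rightarrow> real^6" where
  "nabla = (THE D. levi_civita D)"

definition nijenhuis :: "(real^6 \<Rightarrow> real^6) \<Rightarrow> real^6 \<Rightarrow> real^6 \<Rightarrow> real^6" where
  "nijenhuis J x y = bracket (J x) (J y) - bracket x y - J (bracket (J x) y) - J (bracket x (J y))"

definition class_W34 :: "(real^6 \<Rightarrow> real^6) \<Rightarrow> bool" where
  "class_W34 J \<longleftrightarrow> (\<forall>x y. nijenhuis J x y = 0)"

text \<open>For a distribution \<open>W\<close> with orthogonal complement \<open>W'\<close>, the tensor
  \<open>g(\<nabla>\<^sub>x y, z)\<close>, \<open>x, y \<in> W\<close>, \<open>z \<in> W'\<close>, is \<open>A\<close> if \<open>W\<close> is the vertical and \<open>B\<close> if \<open>W\<close> is the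
  horizontal distribution.\<close>

definition tens :: "real^6 \<Rightarrow> real^6 \<Rightarrow> real^6 \<Rightarrow> real" where
  "tens x y z = nabla x y \<bullet> z"

text \<open>The value does not depend on the chosen orthonormal basis.\<close>

definition trace_over :: "(real^6) set \<Rightarrow> (real^6 \<Rightarrow> real^6 \<Rightarrow> real) \<Rightarrow> real" where
  "trace_over W q =
     (let b = (SOME b. pairwise orthogonal b \<and> (\<forall>x\<in>b. norm x = 1) \<and> span b = W)
      in \<Sum>x\<in>b. q x x)"

definition skew_part :: "real^6 \<Rightarrow> real^6 \<Rightarrow> real^6 \<Rightarrow> real" where
  "skew_part x y z = (tens x y z - tens y x z) / 2"

definition trace_part :: "(real^6) set \<Rightarrow> real^6 \<Rightarrow> real^6 \<Rightarrow> real^6 \<Rightarrow> real" where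
  "trace_part W x y z = (x \<bullet> y) / real (dim W) * trace_over W (\<lambda>a b. tens a b z)"

definition tracefree_part :: "(real^6) set \<Rightarrow> real^6 \<Rightarrow> real^6 \<Rightarrow> real^6 \<Rightarrow> real" where
  "tracefree_part W x y z = (tens x y z + tens y x z) / 2 - trace_part W x y z"

datatype ops_module = V1 | V2 | V3 | V4 | V5 | V6

primrec torsion_component :: "(real^6) set \<Rightarrow> ops_module \<Rightarrow> real^6 \<Rightarrow> real^6 \<Rightarrow> real^6 \<Rightarrow> real" where
  "torsion_component V V1 = skew_part"
| "torsion_component V V2 = tracefree_part V"
| "torsion_component V V3 = trace_part V"
| "torsion_component V V4 = skew_part"
| "torsion_component V V5 = tracefree_part (orthogonal_comp V)"
| "torsion_component V V6 = trace_part (orthogonal_comp V)"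

primrec first_factor :: "(real^6) set \<Rightarrow> ops_module \<Rightarrow> (real^6) set" where
  "first_factor V V1 = V"
| "first_factor V V2 = V"
| "first_factor V V3 = V"
| "first_factor V V4 = orthogonal_comp V"
| "first_factor V V5 = orthogonal_comp V"
| "first_factor V V6 = orthogonal_comp V"

definition ops_class :: "ops_module set \<Rightarrow> (real^6) set \<Rightarrow> bool" where
  "ops_class I V \<longleftrightarrow>
     (\<forall>m. m \<notin> I \<longrightarrow>
        (\<forall>x\<in>first_factor V m. \<forall>y\<in>first_factor V m. \<forall>z\<in>orthogonal_comp (first_factor V m).
           torsion_component V m x y z = 0))"

lemma bilinear_bracket: "bilinear bracket"
  unfolding bilinear_def
  by (auto intro!: linearI simp: bracket_eq vec_eq_iff forall_6 vector_6 algebra_simps)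

lemma ex1_levi_civita: "\<exists>!D. levi_civita D"
proof -
  let ?K = "\<lambda>x y z. (bracket x y \<bullet> z - bracket y z \<bullet> x + bracket z x \<bullet> y) / 2"
  define D where "D = (\<lambda>x y. \<Sum>b\<in>Basis. ?K x y b *\<^sub>R b)"
  note bl = bilinear_ladd[OF bilinear_bracket] bilinear_radd[OF bilinear_bracket]
    bilinear_lmul[OF bilinear_bracket] bilinear_rmul[OF bilinear_bracket]
  have skew: "bracket x y = - bracket y x" for x y
    by (simp add: bracket_eq vec_eq_iff forall_6 vector_6)
  have K: "D x y \<bullet> z = ?K x y z" for x y z
  proof -
    have lin: "linear (\<lambda>z. ?K x y z)"
      by (rule linearI)
        (simp_all add: bl inner_add_left inner_add_right algebra_simps add_divide_distrib diff_divide_distrib)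
    have "D x y \<bullet> z = (\<Sum>b\<in>Basis. ?K x y b * (z \<bullet> b))"
      by (simp add: D_def inner_sum_left inner_commute[of z])
    also have "\<dots> = ?K x y (\<Sum>b\<in>Basis. (z \<bullet> b) *\<^sub>R b)"
      by (subst linear_sum[OF lin]) (simp add: bl algebra_simps)
    finally show ?thesis
      by (simp add: euclidean_representation)
  qed
  have ex: "levi_civita D"
    unfolding levi_civita_def
  proof (intro conjI allI)
    show "bilinear D"
      unfolding bilinear_def
    proof (intro conjI allI linearI)
      show "D x (y + y') = D x y + D x y'" for x y y'
        by (rule vector_eq_rdot[THEN iffD1])
          (simp only: K inner_add_left inner_add_right bl, simp add: field_simps)
      show "D x (r *\<^sub>R y) = r *\<^sub>R D x y" for x r y
        by (rule vector_eq_rdot[THEN iffD1])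
          (simp only: K inner_scaleR_left inner_scaleR_right bl, simp add: field_simps)
      show "D (x + x') y = D x y + D x' y" for x x' y
        by (rule vector_eq_rdot[THEN iffD1])
          (simp only: K inner_add_left inner_add_right bl, simp add: field_simps)
      show "D (r *\<^sub>R x) y = r *\<^sub>R D x y" for x r y
        by (rule vector_eq_rdot[THEN iffD1])
          (simp only: K inner_scaleR_left inner_scaleR_right bl, simp add: field_simps)
    qed
    show "D x y \<bullet> z + y \<bullet> D x z = 0" for x y z
      unfolding inner_commute[of y] K
      using skew[of x y] skew[of y z] skew[of x z] by (simp add: field_simps)
    show "D x y - D y x = bracket x y" for x y
    proof (rule vector_eq_ldot[THEN iffD1], rule allI)
      fix z
      have "bracket y z \<bullet> x = - (bracket z y \<bullet> x)" "bracket z x \<bullet> y = - (bracket x z \<bullet> y)"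
        "bracket y x \<bullet> z = - (bracket x y \<bullet> z)"
        using skew[of y z] skew[of z x] skew[of y x] by simp_all
      then have "?K x y z - ?K y x z = bracket x y \<bullet> z"
        by (simp add: field_simps)
      then show "z \<bullet> (D x y - D y x) = z \<bullet> bracket x y"
        by (simp only: inner_commute[of z] inner_diff_left K)
    qed
  qed
  have uniq: "E x y \<bullet> z = ?K x y z" if "levi_civita E" for E x y z
  proof -
    have m: "E x y \<bullet> z + E x z \<bullet> y = 0" for x y z
      using that by (simp add: levi_civita_def inner_commute)
    have t: "bracket x y \<bullet> z = E x y \<bullet> z - E y x \<bullet> z" for x y z
      using that by (metis levi_civita_def inner_diff_left)
    show ?thesis
      using m[of x y z] m[of y x z] m[of z x y] unfolding t by (simp add: field_simps)
  qed
  have "E = D" if "levi_civita E" for E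
  proof -
    have "E x y = D x y" for x y
      by (rule vector_eq_rdot[THEN iffD1]) (simp only: uniq[OF that] K simp_thms)
    then show ?thesis by (simp add: fun_eq_iff)
  qed
  with ex show ?thesis by blast
qed

section \<open>Mixed structures\<close>

definition OCS :: "(real^6 \<Rightarrow> real^6) set" where
  "OCS = {J. orthogonal_transformation J \<and> (\<forall>x. J (J x) = - x)}"

definition positive_OCS :: "(real^6 \<Rightarrow> real^6) set" where
  "positive_OCS = {J \<in> OCS. \<exists>x y z. det (vector [x, J x, y, J y, z, J z] :: real^6^6) > 0}"

text \<open>An oriented plane is a 2-dimensional subspace together with the set of its positive
  bases.\<close>

type_synonym oriented_plane = "(real^6) set \<times> ((real^6) \<times> (real^6)) set"

definition oriented_planes :: "oriented_plane set" where
  "oriented_planes =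
     {(span {v, w}, {(a *\<^sub>R v + b *\<^sub>R w, c *\<^sub>R v + d *\<^sub>R w) | a b c d. a * d - b * c > 0}) | v w.
        v \<noteq> w \<and> independent {v, w}}"

type_synonym mixed_structure = "(real^6 \<Rightarrow> real^6) \<times> oriented_plane"

definition mixed_structures :: "mixed_structure set" where
  "mixed_structures =
     {(J, V, pos) | J V pos. J \<in> positive_OCS \<and> (V, pos) \<in> oriented_planes \<and>
        J ` V \<subseteq> V \<and> (\<forall>v\<in>V. v \<noteq> 0 \<longrightarrow> (v, J v) \<in> pos)}"

text \<open>2-forms are skew-symmetric matrices, the \<open>(i, j)\<close> entry being the value on
  \<open>(e\<^sub>i, e\<^sub>j)\<close>.\<close>

definition wedge :: "real^6 \<Rightarrow> real^6 \<Rightarrow> real^6^6" where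
  "wedge v w = (\<chi> i j. v$i * w$j - v$j * w$i)"

definition fundamental_form :: "(real^6 \<Rightarrow> real^6) \<Rightarrow> real^6^6" where
  "fundamental_form J = (\<chi> i j. J (axis i 1) \<bullet> axis j 1)"

text \<open>The 2-form \<open>\<omega>\<^sub>J + \<alpha> v \<and> Jv\<close> is the same for all unit vectors \<open>v\<close> of the plane.\<close>

definition ms_form :: "real \<Rightarrow> mixed_structure \<Rightarrow> real^6^6" where
  "ms_form \<alpha> = (\<lambda>(J, V, pos).
     THE \<sigma>. \<exists>v\<in>V. norm v = 1 \<and> \<sigma> = fundamental_form J + \<alpha> *\<^sub>R wedge v (J v))"

definition moment_map :: "real^6^6 \<Rightarrow> real^3" where
  "moment_map \<sigma> = vector [\<sigma>$1$2, \<sigma>$3$4, \<sigma>$5$6]"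

definition W34_V15_structures :: "mixed_structure set" where
  "W34_V15_structures =
     {(J, V, pos) | J V pos. (J, V, pos) \<in> mixed_structures \<and> class_W34 J \<and> ops_class {V1, V5} V}"

end

theory Submission
  imports Defs
begin

text \<open>
Let \<open>Z = \<langle>e\<^sub>5, e\<^sub>6\<rangle>\<close> be the centre of the Heisenberg algebra and \<open>E = \<langle>e\<^sub>1, \<dots>, e\<^sub>4\<rangle>\<close> its
orthogonal complement. All brackets lie in \<open>Z\<close> and depend only on the \<open>E\<close>-parts of their
arguments; \<open>E \<times> E \<rightarrow> Z\<close> is a nonzero alternating form that is complex bilinear for the standard
structure \<open>J\<^sub>0\<close>, and its two real components are self-dual 2-forms on \<open>E\<close>.

\<^emph>\<open>Complex structures.\<close> If \<open>J\<close> is integrable and \<open>x\<close> is central, the Nijenhuis tensor shows that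
\<open>ad (Jx)\<close> commutes with \<open>J\<close>. Unless \<open>Jx\<close> is central, the image of \<open>ad (Jx)\<close> is \<open>Z\<close>, so in any
case \<open>J\<close> preserves \<open>Z\<close> (\<open>W34_preserves_centre\<close>). Hence \<open>J\<close> is a rotation by a right angle on
\<open>Z\<close> together with an orthogonal complex structure of \<open>E\<close>, and the latter has a self-dual or an
anti-self-dual 2-form, given by a point of a 2-sphere (\<open>OCS_preserving_centre\<close>). The orientation
couples the two choices (\<open>acs_positive_OCS\<close>). In the anti-self-dual case the bracket is of type
\<open>(1,1)\<close> and \<open>J\<close> is integrable for every point \<open>s\<close> of the sphere; in the self-dual case the
bracket must be of type \<open>(2,0)\<close>, which happens for \<open>J\<^sub>0\<close> alone (\<open>positive_W34_iff\<close>).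

\<^emph>\<open>Planes.\<close> Let \<open>V\<close> be a \<open>J\<close>-invariant plane. The component in \<open>\<V>\<^sub>4\<close> vanishes if and only if
the orthogonal complement of \<open>V\<close> is a subalgebra. If \<open>V\<close> were not contained in \<open>E\<close>, it would
project onto \<open>Z\<close>, and this subalgebra would be abelian; but it would also project onto \<open>E\<close>, on
which the bracket is not zero. So \<open>V \<subseteq> E\<close> (\<open>V4_zero_imp_noncentral\<close>), and conversely every plane in
\<open>E\<close> is of class \<open>\<V>\<^sub>1\<^sub>5\<close>, because all brackets are orthogonal to it (\<open>noncentral_plane_class\<close>).

\<^emph>\<open>Forms.\<close> Oriented planes in \<open>E\<close> correspond to pairs \<open>(s, t)\<close> of points of the two spheres of
anti-self-dual and self-dual structures \<open>I\<^sub>s\<close>, \<open>B\<^sub>t\<close>: the plane is \<open>{x \<in> E. I\<^sub>s x = B\<^sub>t x}\<close>, and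
its area form is \<open>(I\<^sub>s + B\<^sub>t) / 2\<close> (\<open>plane_wedge\<close>). With \<open>J = I\<^sub>s\<close> on \<open>E\<close> the point \<open>t\<close> is free,
and this gives a product of two spheres; with \<open>J = J\<^sub>0\<close> the point \<open>t\<close> is fixed and \<open>s\<close> is free,
and this gives one more sphere (\<open>W34_V15_structures_eq\<close>). In these parameters the 2-form of the
mixed structure is
\<open>- e\<^sup>5\<^sup>6 + (1 + \<alpha>/2) I\<^sub>s + (\<alpha>/2) B\<^sub>t\<close> and \<open>e\<^sup>5\<^sup>6 + (1 + \<alpha>/2) J\<^sub>0 + (\<alpha>/2) I\<^sub>s\<close> respectively. Both
expressions are affine with a linear left inverse, so they are diffeomorphisms onto their images as
soon as \<open>\<complex>P\<^sup>1\<close> is identified with the round sphere (\<open>hopf_diffeomorphism\<close>); the coefficient of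
\<open>e\<^sup>5\<^sup>6\<close> separates the two pieces. The moment map only sees the first coordinates of \<open>s\<close> and \<open>t\<close>,
which range independently over \<open>[-1, 1]\<close>: the images are an affine image of a square and one of an
interval.
\<close>

section \<open>Calculus of smooth maps\<close>

text \<open>All maps that occur in charts are rational with real denominators, so closure under sums,
bilinear products, inverses of real functions, and composition with linear maps on either side is
a sufficient calculus.\<close>

lemma Ck_on_SucD:
  assumes "Ck_on (Suc n) S f" "x \<in> S"
  shows "(f has_derivative frechet_derivative f (at x)) (at x)"
  using assms frechet_derivative_works by auto

lemma Ck_on_cong:
  assumes "open S" "\<And>x. x \<in> S \<Longrightarrow> f x = g x" "Ck_on n S f"
  shows "Ck_on n S g"
  using assms(2,3)
proof (induction n arbitrary: f g)
  case 0
  then show ?case by (simp cong: continuous_on_cong)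
next
  case (Suc n)
  have "(g has_derivative frechet_derivative f (at x)) (at x)" if "x \<in> S" for x
    by (rule has_derivative_transform_within_open[OF Ck_on_SucD assms(1) that])
      (use Suc.prems that in auto)
  then have *: "g differentiable (at x)" "frechet_derivative g (at x) = frechet_derivative f (at x)"
    if "x \<in> S" for x
    using that by (auto simp: differentiable_def frechet_derivative_at[symmetric])
  have "Ck_on n S (\<lambda>x. frechet_derivative g (at x) v)" for v
    by (rule Suc.IH[of "\<lambda>x. frechet_derivative f (at x) v"]) (use * Suc.prems in auto)
  with * show ?case by simp
qed

text \<open>The derivative of \<open>f\<close> in the definition of \<open>Ck_on\<close> is the Hilbert choice \<open>frechet_derivative\<close>;
this rule allows a closed formula for it instead.\<close>

lemma Ck_on_SucI:
  assumes "open S" "\<And>x. x \<in> S \<Longrightarrow> (f has_derivative f' x) (at x)"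
    and "\<And>v. Ck_on n S (\<lambda>x. f' x v)"
  shows "Ck_on (Suc n) S f"
proof -
  have "frechet_derivative f (at x) = f' x" if "x \<in> S" for x
    using assms(2)[OF that] by (simp add: frechet_derivative_at[symmetric])
  then have "Ck_on n S (\<lambda>x. frechet_derivative f (at x) v)" for v
    by (intro Ck_on_cong[OF assms(1) _ assms(3)]) simp
  with assms(2) show ?thesis
    by (auto simp: differentiable_def)
qed

lemma Ck_on_lower: "Ck_on (Suc n) S f \<Longrightarrow> Ck_on n S f"
proof (induction n arbitrary: f)
  case 0
  then show ?case
    by (auto intro!: continuous_at_imp_continuous_on differentiable_imp_continuous_within)
next
  case (Suc n)
  then show ?case by auto
qed

lemma Ck_on_const: "open S \<Longrightarrow> Ck_on n S (\<lambda>x. c)"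
proof (induction n arbitrary: c)
  case (Suc n)
  then show ?case by (intro Ck_on_SucI[where f' = "\<lambda>x v. 0"]) auto
qed simp

lemma Ck_on_bounded_linear: "open S \<Longrightarrow> bounded_linear f \<Longrightarrow> Ck_on n S f"
proof (cases n)
  case (Suc m)
  assume "open S" "bounded_linear f"
  then show ?thesis unfolding Suc
    by (intro Ck_on_SucI[where f' = "\<lambda>x. f"])
      (auto intro: Ck_on_const bounded_linear_imp_has_derivative)
qed (simp add: linear_continuous_on)

lemma Ck_on_add:
  "open S \<Longrightarrow> Ck_on n S f \<Longrightarrow> Ck_on n S g \<Longrightarrow> Ck_on n S (\<lambda>x. f x + g x)"
proof (induction n arbitrary: f g)
  case (Suc n)
  let ?f' = "\<lambda>x v. frechet_derivative f (at x) v + frechet_derivative g (at x) v"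
  show ?case
  proof (rule Ck_on_SucI[where f' = ?f'])
    show "((\<lambda>x. f x + g x) has_derivative ?f' x) (at x)" if "x \<in> S" for x
      by (rule has_derivative_add) (use Suc.prems that Ck_on_SucD in blast)+
  qed (use Suc in auto)
qed (simp add: continuous_on_add)

lemma Ck_on_bilinear:
  assumes "bounded_bilinear pr" "open S"
  shows "Ck_on n S f \<Longrightarrow> Ck_on n S g \<Longrightarrow> Ck_on n S (\<lambda>x. pr (f x) (g x))"
proof (induction n arbitrary: f g)
  case 0
  then show ?case by (simp add: bounded_bilinear.continuous_on[OF assms(1)])
next
  case (Suc n)
  let ?f' = "\<lambda>x v. pr (f x) (frechet_derivative g (at x) v)
                    + pr (frechet_derivative f (at x) v) (g x)"
  show ?case
  proof (rule Ck_on_SucI[OF assms(2), where f' = ?f'])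
    show "((\<lambda>x. pr (f x) (g x)) has_derivative ?f' x) (at x)" if "x \<in> S" for x
      by (rule bounded_bilinear.FDERIV[OF assms(1)]) (use Suc.prems that Ck_on_SucD in blast)+
    show "Ck_on n S (\<lambda>x. ?f' x v)" for v
      by (intro Ck_on_add assms(2) Suc.IH) (use Suc.prems Ck_on_lower in auto)
  qed
qed

lemma Ck_on_linear_compose:
  assumes "bounded_linear h" "open S"
  shows "Ck_on n S f \<Longrightarrow> Ck_on n S (\<lambda>x. h (f x))"
proof (induction n arbitrary: f)
  case 0
  then show ?case by (simp add: bounded_linear.continuous_on[OF assms(1)])
next
  case (Suc n)
  show ?case
  proof (rule Ck_on_SucI[OF assms(2), where f' = "\<lambda>x v. h (frechet_derivative f (at x) v)"])
    show "((\<lambda>x. h (f x)) has_derivative (\<lambda>v. h (frechet_derivative f (at x) v))) (at x)"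
      if "x \<in> S" for x
      by (rule bounded_linear.has_derivative[OF assms(1)]) (use Suc.prems that Ck_on_SucD in blast)
  qed (use Suc in auto)
qed

lemma Ck_on_compose_linear:
  assumes "bounded_linear h" "open S" "open T" "h ` T \<subseteq> S"
  shows "Ck_on n S f \<Longrightarrow> Ck_on n T (\<lambda>x. f (h x))"
proof (induction n arbitrary: f)
  case 0
  then show ?case
    using continuous_on_compose2[of S f T h] assms by (simp add: linear_continuous_on)
next
  case (Suc n)
  show ?case
  proof (rule Ck_on_SucI[OF assms(3), where f' = "\<lambda>x v. frechet_derivative f (at (h x)) (h v)"])
    show "((\<lambda>x. f (h x)) has_derivative (\<lambda>v. frechet_derivative f (at (h x)) (h v))) (at x)"
      if "x \<in> T" for x
      by (rule has_derivative_compose[OF bounded_linear_imp_has_derivative[OF assms(1)]])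
        (use Suc.prems that assms(4) Ck_on_SucD in blast)
  qed (use Suc in auto)
qed

lemma Ck_on_inverse:
  fixes f :: "'a::real_normed_vector \<Rightarrow> real"
  assumes "open S" "\<And>x. x \<in> S \<Longrightarrow> f x \<noteq> 0"
  shows "Ck_on n S f \<Longrightarrow> Ck_on n S (\<lambda>x. inverse (f x))"
proof (induction n)
  case 0
  then show ?case using assms(2) by (auto intro!: continuous_intros)
next
  case (Suc n)
  note mult = Ck_on_bilinear[OF bounded_bilinear_mult assms(1)]
  let ?f' = "\<lambda>x v. - (inverse (f x) * frechet_derivative f (at x) v * inverse (f x))"
  show ?case
  proof (rule Ck_on_SucI[OF assms(1), where f' = ?f'])
    show "((\<lambda>x. inverse (f x)) has_derivative ?f' x) (at x)" if "x \<in> S" for x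
      by (rule Deriv.has_derivative_inverse) (use that assms(2) Suc.prems Ck_on_SucD in blast)+
    show "Ck_on n S (\<lambda>x. ?f' x v)" for v
      by (intro Ck_on_linear_compose[OF bounded_linear_minus[OF bounded_linear_ident]] mult assms(1) Suc.IH)
        (use Suc.prems Ck_on_lower in auto)
  qed
qed

lemma smooth_on_cong:
  "open S \<Longrightarrow> (\<And>x. x \<in> S \<Longrightarrow> f x = g x) \<Longrightarrow> smooth_on S f \<Longrightarrow> smooth_on S g"
  unfolding smooth_on_def using Ck_on_cong by blast

lemma smooth_on_const: "open S \<Longrightarrow> smooth_on S (\<lambda>x. c)"
  by (simp add: smooth_on_def Ck_on_const)

lemma smooth_on_bounded_linear: "open S \<Longrightarrow> bounded_linear f \<Longrightarrow> smooth_on S f"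
  by (simp add: smooth_on_def Ck_on_bounded_linear)

lemma smooth_on_add:
  "open S \<Longrightarrow> smooth_on S f \<Longrightarrow> smooth_on S g \<Longrightarrow> smooth_on S (\<lambda>x. f x + g x)"
  by (simp add: smooth_on_def Ck_on_add)

lemma smooth_on_bilinear:
  "bounded_bilinear pr \<Longrightarrow> open S \<Longrightarrow> smooth_on S f \<Longrightarrow> smooth_on S g \<Longrightarrow>
    smooth_on S (\<lambda>x. pr (f x) (g x))"
  by (simp add: smooth_on_def Ck_on_bilinear)

lemma smooth_on_linear_compose:
  "bounded_linear h \<Longrightarrow> open S \<Longrightarrow> smooth_on S f \<Longrightarrow> smooth_on S (\<lambda>x. h (f x))"
  by (simp add: smooth_on_def Ck_on_linear_compose)

lemma smooth_on_compose_linear: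
  "bounded_linear h \<Longrightarrow> open S \<Longrightarrow> open T \<Longrightarrow> h ` T \<subseteq> S \<Longrightarrow> smooth_on S f \<Longrightarrow>
    smooth_on T (\<lambda>x. f (h x))"
  unfolding smooth_on_def using Ck_on_compose_linear by blast

lemma smooth_on_divide:
  fixes f g :: "'a::real_normed_vector \<Rightarrow> real"
  assumes "open S" "smooth_on S f" "smooth_on S g" "\<And>x. x \<in> S \<Longrightarrow> g x \<noteq> 0"
  shows "smooth_on S (\<lambda>x. f x / g x)"
  unfolding divide_inverse
  using assms by (auto simp: smooth_on_def intro!: Ck_on_bilinear[OF bounded_bilinear_mult] Ck_on_inverse)

lemma smooth_on_Pair:
  fixes f :: "'a::real_normed_vector \<Rightarrow> 'b::real_normed_vector"
    and g :: "'a \<Rightarrow> 'c::real_normed_vector"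
  assumes "open S" "smooth_on S f" "smooth_on S g"
  shows "smooth_on S (\<lambda>x. (f x, g x))"
proof -
  have "bounded_linear (\<lambda>y::'b. (y, 0::'c))" "bounded_linear (\<lambda>z::'c. (0::'b, z))"
    by (auto intro!: bounded_linear_Pair bounded_linear_ident bounded_linear_zero)
  then have "smooth_on S (\<lambda>x. (f x, 0) + (0, g x))"
    by (rule smooth_on_add[OF assms(1) smooth_on_linear_compose[OF _ assms(1,2)]
          smooth_on_linear_compose[OF _ assms(1,3)]])
  then show ?thesis by simp
qed

lemma smooth_on_vector_3:
  fixes f g h :: "'a::real_normed_vector \<Rightarrow> real"
  assumes S: "open S" and f: "smooth_on S f" and g: "smooth_on S g" and h: "smooth_on S h"
  shows "smooth_on S (\<lambda>x. vector [f x, g x, h x] :: real^3)"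
proof -
  have "(vector [a, b, c] :: real^3) = a *\<^sub>R axis 1 1 + b *\<^sub>R axis 2 1 + c *\<^sub>R axis 3 1" for a b c
    by (simp add: vec_eq_iff forall_3 axis_def)
  moreover note lin = bounded_linear_scaleR_left
  ultimately show ?thesis
    by (simp only:) (rule smooth_on_add[OF S smooth_on_add[OF S smooth_on_linear_compose[OF lin S f]
      smooth_on_linear_compose[OF lin S g]] smooth_on_linear_compose[OF lin S h]])
qed

lemma smooth_on_Complex:
  fixes f g :: "'a::real_normed_vector \<Rightarrow> real"
  assumes S: "open S" and f: "smooth_on S f" and g: "smooth_on S g"
  shows "smooth_on S (\<lambda>x. Complex (f x) (g x))"
proof -
  have "Complex a b = a *\<^sub>R 1 + b *\<^sub>R \<i>" for a b
    by (simp add: complex_eq_iff)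
  moreover note lin = bounded_linear_scaleR_left
  ultimately show ?thesis
    by (simp only:) (rule smooth_on_add[OF S smooth_on_linear_compose[OF lin S f]
      smooth_on_linear_compose[OF lin S g]])
qed

section \<open>Diffeomorphisms onto subsets\<close>

lemma bij_betw_left_inverse_image:
  assumes "bij_betw f A S" "\<And>x. x \<in> S \<Longrightarrow> R (T x) = x"
  shows "bij_betw (T \<circ> f) A (T ` S)"
  using assms by (intro bij_betw_trans[OF assms(1)] bij_betw_byWitness[where f' = R]) auto

lemma diffeomorphism_onto_inj: "diffeomorphism_onto A f S \<Longrightarrow> inj_on f (points A)"
  by (simp add: diffeomorphism_onto_def bij_betw_def)

text \<open>Charts with open images are what makes the derivatives of the two coordinate expressions agree:
the functions coincide there, but not necessarily elsewhere.\<close>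

lemma diffeomorphism_onto_cong:
  assumes diff: "diffeomorphism_onto A f S"
    and charts: "\<And>U \<phi>. (U, \<phi>) \<in> A \<Longrightarrow> open (\<phi> ` U)"
    and eq: "\<And>x. x \<in> points A \<Longrightarrow> f x = g x"
  shows "diffeomorphism_onto A g S"
  unfolding diffeomorphism_onto_def
proof (intro conjI ballI, safe)
  show "bij_betw g (points A) S"
    using diff eq by (auto simp: diffeomorphism_onto_def cong: bij_betw_cong)
  fix U \<phi> assume U: "(U, \<phi>) \<in> A"
  then have sub: "U \<subseteq> points A" by (auto simp: points_def)
  have "smooth_on (\<phi> ` U) (f \<circ> inv_into U \<phi>)"
    using diff U by (auto simp: diffeomorphism_onto_def)
  moreover have "(f \<circ> inv_into U \<phi>) y = (g \<circ> inv_into U \<phi>) y" if "y \<in> \<phi> ` U" for y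
    using eq[of "inv_into U \<phi> y"] inv_into_into[OF that] sub by auto
  ultimately show "smooth_on (\<phi> ` U) (g \<circ> inv_into U \<phi>)"
    by (rule smooth_on_cong[OF charts[OF U], rotated])
  fix p assume p: "p \<in> U"
  with diff U obtain W h where W: "open W" "f p \<in> W" "smooth_on W h"
    "\<And>q. q \<in> points A \<Longrightarrow> f q \<in> W \<Longrightarrow> q \<in> U \<and> \<phi> q = h (f q)"
    unfolding diffeomorphism_onto_def by fastforce
  show "\<exists>W h. open W \<and> g p \<in> W \<and> smooth_on W h \<and>
      (\<forall>q\<in>points A. g q \<in> W \<longrightarrow> q \<in> U \<and> \<phi> q = h (g q))"
    using W p sub eq by (intro exI[of _ W] exI[of _ h]) (auto simp: subset_iff)
qed

text \<open>A linear left inverse \<open>R\<close> of the affine map carries the smooth extensions of the coordinates from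
the old ambient space to the new one, by composition with \<open>R\<close> on the preimage of their domain.\<close>

lemma diffeomorphism_onto_affine_image:
  fixes f :: "'m \<Rightarrow> 'f::euclidean_space" and L :: "'f \<Rightarrow> 'g::euclidean_space"
  assumes diff: "diffeomorphism_onto A f S"
    and charts: "\<And>U \<phi>. (U, \<phi>) \<in> A \<Longrightarrow> open (\<phi> ` U)"
    and L: "linear L" and R: "linear R" "\<And>x. R (c + L x) = x"
  shows "diffeomorphism_onto A ((\<lambda>x. c + L x) \<circ> f) ((\<lambda>x. c + L x) ` S)"
  unfolding diffeomorphism_onto_def
proof (intro conjI ballI, safe)
  let ?T = "\<lambda>x. c + L x"
  note R_lin = linear_conv_bounded_linear[THEN iffD1, OF R(1)]
  note L_lin = linear_conv_bounded_linear[THEN iffD1, OF L]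
  show "bij_betw (?T \<circ> f) (points A) (?T ` S)"
    using diff R(2) by (intro bij_betw_left_inverse_image[of f _ S R]) (auto simp: diffeomorphism_onto_def)
  fix U \<phi> assume U: "(U, \<phi>) \<in> A"
  then have "smooth_on (\<phi> ` U) (f \<circ> inv_into U \<phi>)"
    using diff by (auto simp: diffeomorphism_onto_def)
  then have "smooth_on (\<phi> ` U) (\<lambda>x. ?T ((f \<circ> inv_into U \<phi>) x))"
    by (rule smooth_on_add[OF charts[OF U] smooth_on_const[OF charts[OF U]]
          smooth_on_linear_compose[OF L_lin charts[OF U]]])
  then show "smooth_on (\<phi> ` U) (?T \<circ> f \<circ> inv_into U \<phi>)"
    by (simp add: comp_def)
  fix p assume "p \<in> U"
  with diff U obtain W g where W: "open W" "f p \<in> W" "smooth_on W g"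
    "\<And>q. q \<in> points A \<Longrightarrow> f q \<in> W \<Longrightarrow> q \<in> U \<and> \<phi> q = g (f q)"
    unfolding diffeomorphism_onto_def by fastforce
  have "open (R -` W)"
    using W(1) R_lin by (intro open_vimage) (auto simp: linear_continuous_on)
  moreover have "smooth_on (R -` W) (\<lambda>y. g (R y))"
    by (rule smooth_on_compose_linear[OF R_lin W(1) \<open>open (R -` W)\<close> _ W(3)]) auto
  ultimately show "\<exists>W g. open W \<and> (?T \<circ> f) p \<in> W \<and> smooth_on W g \<and>
      (\<forall>q\<in>points A. (?T \<circ> f) q \<in> W \<longrightarrow> q \<in> U \<and> \<phi> q = g ((?T \<circ> f) q))"
    using W R(2) by (intro exI[of _ "R -` W"] exI[of _ "\<lambda>y. g (R y)"]) simp
qed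

text \<open>Injectivity of the charts ensures that \<open>inv_into\<close> of a product chart is the product of the
inverses.\<close>

lemma diffeomorphism_onto_product:
  fixes f :: "'m \<Rightarrow> 'f::euclidean_space" and g :: "'n \<Rightarrow> 'g::euclidean_space"
    and A :: "('m, 'e::euclidean_space) atlas" and B :: "('n, 'h::euclidean_space) atlas"
  assumes f: "diffeomorphism_onto A f S" and g: "diffeomorphism_onto B g T"
    and A: "\<And>U \<phi>. (U, \<phi>) \<in> A \<Longrightarrow> open (\<phi> ` U) \<and> inj_on \<phi> U"
    and B: "\<And>U \<phi>. (U, \<phi>) \<in> B \<Longrightarrow> open (\<phi> ` U) \<and> inj_on \<phi> U"
  shows "diffeomorphism_onto (product_atlas A B) (map_prod f g) (S \<times> T)"
  unfolding diffeomorphism_onto_def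
proof (intro conjI ballI, safe)
  show "bij_betw (map_prod f g) (points (product_atlas A B)) (S \<times> T)"
    using f g by (auto simp: diffeomorphism_onto_def points_product_atlas intro: bij_betw_map_prod)
  fix X \<psi> assume "(X, \<psi>) \<in> product_atlas A B"
  then obtain U \<phi> U' \<phi>' where X: "X = U \<times> U'" and \<psi>: "\<psi> = map_prod \<phi> \<phi>'"
    and U: "(U, \<phi>) \<in> A" and U': "(U', \<phi>') \<in> B"
    by (auto simp: product_atlas_def)
  let ?D = "\<phi> ` U \<times> \<phi>' ` U'"
  have D: "\<psi> ` X = ?D" "open ?D"
    using A[OF U] B[OF U'] by (auto simp: X \<psi> open_Times)
  have inv: "inv_into X \<psi> (a, b) = (inv_into U \<phi> a, inv_into U' \<phi>' b)"
    if "a \<in> \<phi> ` U" "b \<in> \<phi>' ` U'" for a b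
    using that A[OF U] B[OF U'] unfolding X \<psi>
    by (intro inv_into_f_eq) (auto simp: inj_on_def)
  have "smooth_on (\<phi> ` U) (f \<circ> inv_into U \<phi>)" "smooth_on (\<phi>' ` U') (g \<circ> inv_into U' \<phi>')"
    using f g U U' by (auto simp: diffeomorphism_onto_def)
  then have "smooth_on ?D (\<lambda>x. (f \<circ> inv_into U \<phi>) (fst x))"
    and "smooth_on ?D (\<lambda>x. (g \<circ> inv_into U' \<phi>') (snd x))"
    using A[OF U] B[OF U'] D(2)
     smooth_on_compose_linear[OF bounded_linear_fst, of "\<phi> ` U" ?D "f \<circ> inv_into U \<phi>"]
     smooth_on_compose_linear[OF bounded_linear_snd, of "\<phi>' ` U'" ?D "g \<circ> inv_into U' \<phi>'"]
    by auto
  then have "smooth_on ?D (\<lambda>x. ((f \<circ> inv_into U \<phi>) (fst x), (g \<circ> inv_into U' \<phi>') (snd x)))"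
    by (intro smooth_on_Pair D)
  then show "smooth_on (\<psi> ` X) (map_prod f g \<circ> inv_into X \<psi>)"
    unfolding D(1) by (rule smooth_on_cong[OF D(2), rotated]) (auto simp: inv)
  fix p q assume "(p, q) \<in> X"
  then have pq: "p \<in> U" "q \<in> U'" by (auto simp: X)
  obtain W h where W: "open W" "f p \<in> W" "smooth_on W h"
    "\<And>q. q \<in> points A \<Longrightarrow> f q \<in> W \<Longrightarrow> q \<in> U \<and> \<phi> q = h (f q)"
    using f U pq(1) unfolding diffeomorphism_onto_def by fastforce
  obtain W' h' where W': "open W'" "g q \<in> W'" "smooth_on W' h'"
    "\<And>q. q \<in> points B \<Longrightarrow> g q \<in> W' \<Longrightarrow> q \<in> U' \<and> \<phi>' q = h' (g q)"
    using g U' pq(2) unfolding diffeomorphism_onto_def by fastforce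
  have "open (W \<times> W')" using W(1) W'(1) by (rule open_Times)
  moreover have "smooth_on (W \<times> W') (\<lambda>x. (h (fst x), h' (snd x)))"
    using W W' \<open>open (W \<times> W')\<close>
    by (intro smooth_on_Pair smooth_on_compose_linear[where h = fst and S = W]
        smooth_on_compose_linear[where h = snd and S = W'])
      (auto simp: bounded_linear_fst bounded_linear_snd)
  ultimately show "\<exists>W k. open W \<and> map_prod f g (p, q) \<in> W \<and> smooth_on W k \<and>
      (\<forall>r\<in>points (product_atlas A B). map_prod f g r \<in> W \<longrightarrow> r \<in> X \<and> \<psi> r = k (map_prod f g r))"
    using W W' by (intro exI[of _ "W \<times> W'"] exI[of _ "\<lambda>x. (h (fst x), h' (snd x))"])
      (auto simp: points_product_atlas X \<psi>)
qed

section \<open>Orientation of complex frames\<close>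

lemma UNIV_6: "(UNIV :: 6 set) = {1, 2, 3, 4, 5, 6}"
  using exhaust_6 by auto

lemma sum_6: "sum f (UNIV :: 6 set) = f 1 + f 2 + f 3 + f 4 + f 5 + f 6"
  unfolding UNIV_6 by (simp add: ac_simps)

lemma prod_6: "prod f (UNIV :: 6 set) = f 1 * f 2 * f 3 * f 4 * f 5 * f 6"
  unfolding UNIV_6 by (simp add: ac_simps)

lemma inner_6: "(x :: real^6) \<bullet> y = x$1*y$1 + x$2*y$2 + x$3*y$3 + x$4*y$4 + x$5*y$5 + x$6*y$6"
  by (simp add: inner_vec_def sum_6)

text \<open>Right multiplication by \<open>A\<close> on complex row vectors, in the real basis
\<open>\<epsilon>\<^sub>1, i \<epsilon>\<^sub>1, \<epsilon>\<^sub>2, i \<epsilon>\<^sub>2, \<epsilon>\<^sub>3, i \<epsilon>\<^sub>3\<close>.\<close>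

definition realify :: "complex^3^3 \<Rightarrow> real^6^6" where
  "realify A = vector
    [vector [Re (A$1$1), Im (A$1$1), Re (A$1$2), Im (A$1$2), Re (A$1$3), Im (A$1$3)],
     vector [-Im (A$1$1), Re (A$1$1), -Im (A$1$2), Re (A$1$2), -Im (A$1$3), Re (A$1$3)],
     vector [Re (A$2$1), Im (A$2$1), Re (A$2$2), Im (A$2$2), Re (A$2$3), Im (A$2$3)],
     vector [-Im (A$2$1), Re (A$2$1), -Im (A$2$2), Re (A$2$2), -Im (A$2$3), Re (A$2$3)],
     vector [Re (A$3$1), Im (A$3$1), Re (A$3$2), Im (A$3$2), Re (A$3$3), Im (A$3$3)],
     vector [-Im (A$3$1), Re (A$3$1), -Im (A$3$2), Re (A$3$2), -Im (A$3$3), Re (A$3$3)]]"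

lemma realify_mult: "realify (A ** B) = realify A ** realify B"
  by (simp add: realify_def vec_eq_iff forall_6 vector_6 matrix_matrix_mult_def sum_6 sum_3
      algebra_simps)

lemma realify_mat_1: "realify (mat 1) = mat 1"
  by (simp add: realify_def vec_eq_iff forall_6 vector_6 mat_def)

lemma det_realify_nz:
  assumes "invertible A"
  shows "det (realify A) \<noteq> 0"
proof -
  obtain B where "A ** B = mat 1"
    using assms by (auto simp: invertible_def)
  then have "det (realify A) * det (realify B) = 1"
    by (metis det_I det_mul realify_mat_1 realify_mult)
  then show ?thesis by auto
qed

text \<open>The determinant of the pencil is a polynomial in \<open>z\<close> with value \<open>1\<close> at \<open>z = 0\<close>.\<close>

lemma finite_singular_pencil:
  fixes A :: "complex^3^3"
  shows "finite {z. det (\<chi> i j. (1 - z) * of_bool (i = j) + z * A$i$j) = 0}"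
proof -
  define P where "P = det (\<chi> i j. [: of_bool (i = j), A$i$j - of_bool (i = j) :])"
  have *: "poly P z = det (\<chi> i j. (1 - z) * of_bool (i = j) + z * A$i$j)" for z
    by (simp add: P_def det_3 algebra_simps)
  have "poly P 0 = 1"
    unfolding * by (simp add: det_3)
  then have "P \<noteq> 0" by auto
  from poly_roots_finite[OF this] show ?thesis by (simp add: *)
qed

text \<open>In fact the determinant is \<open>\<bar>det A\<bar>\<^sup>2\<close>, but the sign has a proof without expanding: if \<open>A\<close> is
invertible, the line through the unit matrix and \<open>A\<close> meets the singular matrices in finitely many
complex parameters. What remains of the parameter plane is connected, so the determinant, which is
continuous and nonzero there, has at \<open>A\<close> the same sign as at the unit matrix.\<close>

lemma det_realify_nonneg: "det (realify A) \<ge> 0"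
proof (cases "invertible A")
  case False
  have "\<exists>u. u \<noteq> 0 \<and> A *v u = 0"
    using False by (metis invertible_left_inverse matrix_left_invertible_ker)
  then obtain u where u: "u \<noteq> 0" "A *v u = 0" by blast
  \<comment> \<open>The real part of \<open>A u\<close> pairs \<open>Re A\<close> with \<open>Re u\<close> and \<open>Im A\<close> with \<open>- Im u\<close>.\<close>
  let ?u = "vector [Re (u$1), -Im (u$1), Re (u$2), -Im (u$2), Re (u$3), -Im (u$3)] :: real^6"
  have "realify A *v ?u = 0"
    using u(2) by (simp add: realify_def vec_eq_iff forall_6 vector_6 matrix_vector_mult_def sum_6
      sum_3 forall_3 complex_eq_iff algebra_simps)
  moreover have "?u \<noteq> 0"
    using u(1) by (auto simp: vec_eq_iff forall_6 forall_3 vector_6 complex_eq_iff)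
  ultimately have "\<not> invertible (realify A)"
    by (metis invertible_left_inverse matrix_left_invertible_ker)
  then show ?thesis by (simp add: invertible_det_nz)
next
  case True
  define M where "M z = (\<chi> i j. (1 - z) * of_bool (i = j) + z * A$i$j)" for z
  define C where "C = UNIV - {z. det (M z) = 0}"
  have "connected C"
    unfolding C_def M_def
    by (intro connected_open_diff_countable countable_finite finite_singular_pencil) auto
  moreover have "continuous_on C (\<lambda>z. det (realify (M z)))"
  proof -
    have "continuous_on C (\<lambda>z. realify (M z) $ i $ j)" for i j
      using exhaust_6[of i] exhaust_6[of j]
      by (elim disjE) (simp_all add: realify_def vector_6 M_def, (intro continuous_intros)+)
    then show ?thesis
      unfolding det_def
      by (intro continuous_on_sum continuous_on_mult continuous_on_prod continuous_on_const)
  qed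
  ultimately have conn: "connected ((\<lambda>z. det (realify (M z))) ` C)"
    by (rule connected_continuous_image[rotated])
  have nz: "det (realify (M z)) \<noteq> 0" if "z \<in> C" for z
    using that by (intro det_realify_nz) (simp add: C_def invertible_det_nz)
  have "M 0 = mat 1" "M 1 = A"
    by (simp_all add: M_def mat_def vec_eq_iff of_bool_def)
  then have "0 \<in> C" "1 \<in> C" "det (realify (M 0)) = 1" "det (realify (M 1)) = det (realify A)"
    using True by (simp_all add: C_def realify_mat_1 invertible_det_nz)
  then have "{det (realify A), 1} \<subseteq> (\<lambda>z. det (realify (M z))) ` C"
    by (metis empty_subsetI image_eqI insert_subset)
  show ?thesis
  proof (rule ccontr)
    assume "\<not> 0 \<le> det (realify A)"
    then have "0 \<in> (\<lambda>z. det (realify (M z))) ` C"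
      using connectedD_interval[OF conn, of "det (realify A)" 1 0]
        \<open>{det (realify A), 1} \<subseteq> (\<lambda>z. det (realify (M z))) ` C\<close> by auto
    then show False using nz by auto
  qed
qed

definition frame_det :: "(real^6 \<Rightarrow> real^6) \<Rightarrow> real^6 \<Rightarrow> real^6 \<Rightarrow> real^6 \<Rightarrow> real" where
  "frame_det J x y z = det (vector [x, J x, y, J y, z, J z] :: real^6^6)"

text \<open>Two frames of the form \<open>(x, Jx, y, Jy, z, Jz)\<close> differ by a complex matrix, whose real determinant
is nonnegative. So one frame with nonzero determinant decides the orientation of \<open>J\<close>.\<close>

lemma frame_det_same_sign:
  assumes J: "linear J" "\<And>x. J (J x) = - x" and "frame_det J a b c \<noteq> 0"
  shows "frame_det J x y z * frame_det J a b c \<ge> 0"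
proof -
  define F where "F = (vector [a, J a, b, J b, c, J c] :: real^6^6)"
  have "invertible F"
    using assms(3) by (simp add: F_def frame_det_def invertible_det_nz)
  then obtain G where G: "G ** F = mat 1"
    by (auto simp: invertible_def)
  define k where "k x = x v* G" for x :: "real^6"
  have expand: "x = k x$1 *\<^sub>R a + k x$2 *\<^sub>R J a + k x$3 *\<^sub>R b + k x$4 *\<^sub>R J b
      + k x$5 *\<^sub>R c + k x$6 *\<^sub>R J c" for x
  proof -
    have "x = k x v* F"
      by (simp add: k_def vector_matrix_mul_assoc G)
    also have "\<dots> = (\<Sum>i\<in>UNIV. k x$i *\<^sub>R F$i)"
      by (simp add: vec_eq_iff vector_matrix_mult_def mult.commute)
    finally show ?thesis
      by (simp add: sum_6 F_def vector_6)
  qed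
  have Jexpand: "J x = - k x$2 *\<^sub>R a + k x$1 *\<^sub>R J a - k x$4 *\<^sub>R b + k x$3 *\<^sub>R J b
      - k x$6 *\<^sub>R c + k x$5 *\<^sub>R J c" for x
    by (subst expand[of x], simp only: linear_add[OF J(1)] linear_scale[OF J(1)] J(2)) simp
  define row where
    "row x = (vector [Complex (k x$1) (k x$2), Complex (k x$3) (k x$4), Complex (k x$5) (k x$6)]
      :: complex^3)" for x
  define A where "A = (vector [row x, row y, row z] :: complex^3^3)"
  have comp: "x $ i = k x$1 * a$i + k x$2 * J a$i + k x$3 * b$i + k x$4 * J b$i
      + k x$5 * c$i + k x$6 * J c$i" for x i
    by (subst expand[of x]) simp
  have Jcomp: "J x $ i = - k x$2 * a$i + k x$1 * J a$i - k x$4 * b$i + k x$3 * J b$i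
      - k x$6 * c$i + k x$5 * J c$i" for x i
    by (subst Jexpand[of x]) simp
  have "vector [x, J x, y, J y, z, J z] = realify A ** F"
    unfolding vec_eq_iff matrix_matrix_mult_def
    by (simp add: forall_6[where P = "\<lambda>i. \<forall>j. Q i j" for Q] vector_6 sum_6 realify_def A_def row_def F_def
        comp[of x] comp[of y] comp[of z] Jcomp[of x] Jcomp[of y] Jcomp[of z])
  then have "frame_det J x y z = det (realify A) * frame_det J a b c"
    by (simp add: frame_det_def det_mul F_def)
  then show ?thesis
    using det_realify_nonneg[of A] by (simp add: mult.assoc)
qed

section \<open>Quaternionic structures on the complement of the centre\<close>

text \<open>On \<open>E\<close> this is multiplication by the imaginary quaternion \<open>s\<close>, from the one side for \<open>\<kappa> = 1\<close>
and from the other for \<open>\<kappa> = -1\<close>. The corresponding 2-forms are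
\<open>s\<^sub>1 (e\<^sup>1\<^sup>2 - \<kappa> e\<^sup>3\<^sup>4) + s\<^sub>2 (e\<^sup>1\<^sup>3 + \<kappa> e\<^sup>2\<^sup>4) + s\<^sub>3 (e\<^sup>1\<^sup>4 - \<kappa> e\<^sup>2\<^sup>3)\<close>: anti-self-dual for \<open>\<kappa> = 1\<close>
and self-dual for \<open>\<kappa> = -1\<close>. On \<open>Z\<close> it is zero.\<close>

definition quat :: "real \<Rightarrow> real^3 \<Rightarrow> real^6 \<Rightarrow> real^6" where
  "quat \<kappa> s x = vector
     [- s$1 * x$2 - s$2 * x$3 - s$3 * x$4,
      s$1 * x$1 + \<kappa> * (s$3 * x$3 - s$2 * x$4),
      s$2 * x$1 + \<kappa> * (s$1 * x$4 - s$3 * x$2),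
      s$3 * x$1 + \<kappa> * (s$2 * x$2 - s$1 * x$3), 0, 0]"

definition rot56 :: "real^6 \<Rightarrow> real^6" where
  "rot56 x = vector [0, 0, 0, 0, - x$6, x$5]"

definition acs :: "real \<Rightarrow> real^3 \<Rightarrow> real \<Rightarrow> real^6 \<Rightarrow> real^6" where
  "acs \<kappa> s \<epsilon> x = quat \<kappa> s x + \<epsilon> *\<^sub>R rot56 x"

lemma quat_nth:
  "quat \<kappa> s x $ 1 = - s$1 * x$2 - s$2 * x$3 - s$3 * x$4"
  "quat \<kappa> s x $ 2 = s$1 * x$1 + \<kappa> * (s$3 * x$3 - s$2 * x$4)"
  "quat \<kappa> s x $ 3 = s$2 * x$1 + \<kappa> * (s$1 * x$4 - s$3 * x$2)"
  "quat \<kappa> s x $ 4 = s$3 * x$1 + \<kappa> * (s$2 * x$2 - s$1 * x$3)"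
  "quat \<kappa> s x $ 5 = 0" "quat \<kappa> s x $ 6 = 0"
  by (simp_all add: quat_def vector_6)

lemma rot56_nth:
  "rot56 x $ 1 = 0" "rot56 x $ 2 = 0" "rot56 x $ 3 = 0" "rot56 x $ 4 = 0"
  "rot56 x $ 5 = - x$6" "rot56 x $ 6 = x$5"
  by (simp_all add: rot56_def vector_6)

lemmas acs_nth = quat_nth rot56_nth

lemma sphere_3: "(s :: real^3) \<in> sphere 0 1 \<longleftrightarrow> (s$1)\<^sup>2 + (s$2)\<^sup>2 + (s$3)\<^sup>2 = 1"
  by (simp add: norm_eq_1 inner_vec_def sum_3 power2_eq_square)

lemma linear_acs: "linear (acs \<kappa> s \<epsilon>)"
  by (rule linearI; simp add: acs_def vec_eq_iff forall_6 acs_nth algebra_simps)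

lemma acs_skew: "\<kappa> = 1 \<or> \<kappa> = -1 \<Longrightarrow> acs \<kappa> s \<epsilon> x \<bullet> y = - (x \<bullet> acs \<kappa> s \<epsilon> y)"
  by (simp add: acs_def inner_6 acs_nth algebra_simps)

lemma acs_square:
  assumes "s \<in> sphere 0 1" "\<kappa> = 1 \<or> \<kappa> = -1" "\<epsilon> = 1 \<or> \<epsilon> = -1"
  shows "acs \<kappa> s \<epsilon> (acs \<kappa> s \<epsilon> x) = - x"
proof -
  define r where "r = (s$1)\<^sup>2 + (s$2)\<^sup>2 + (s$3)\<^sup>2"
  have "\<kappa> * \<kappa> = 1" "\<epsilon> * \<epsilon> = 1" using assms(2,3) by auto
  then have "acs \<kappa> s \<epsilon> (acs \<kappa> s \<epsilon> x)
    = vector [- r * x$1, - r * x$2, - r * x$3, - r * x$4, - x$5, - x$6]"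
    using assms(2,3)
    by (auto simp: acs_def vec_eq_iff forall_6 acs_nth vector_6 r_def power2_eq_square algebra_simps)
  moreover have "r = 1"
    using assms(1) by (simp only: sphere_3 r_def)
  ultimately show ?thesis
    by (simp add: vec_eq_iff forall_6 vector_6)
qed

lemma acs_OCS:
  assumes "s \<in> sphere 0 1" "\<kappa> = 1 \<or> \<kappa> = -1" "\<epsilon> = 1 \<or> \<epsilon> = -1"
  shows "acs \<kappa> s \<epsilon> \<in> OCS"
  by (simp add: OCS_def orthogonal_transformation_def linear_acs acs_skew[OF assms(2)]
      acs_square[OF assms])

text \<open>Since \<open>J e\<^sub>1 = s\<^sub>1 e\<^sub>2 + p\<close> and \<open>J e\<^sub>2 = - s\<^sub>1 e\<^sub>1 + \<kappa> q\<close>, where \<open>p = s\<^sub>2 e\<^sub>3 + s\<^sub>3 e\<^sub>4\<close> and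
\<open>q = - s\<^sub>3 e\<^sub>3 + s\<^sub>2 e\<^sub>4\<close>, the frame is obtained from \<open>(e\<^sub>1, e\<^sub>2, p, q, e\<^sub>5, e\<^sub>6)\<close>, which is the
real form of a diagonal matrix, by a matrix that becomes triangular after exchanging two rows.\<close>

lemma acs_frame_det:
  assumes \<kappa>: "\<kappa> = 1 \<or> \<kappa> = -1"
  shows "frame_det (acs \<kappa> s \<epsilon>) (axis 1 1) (axis 2 1) (axis 5 1) = - \<kappa> * \<epsilon> * 
     det (realify (vector [vector [1, 0, 0], vector [0, Complex (s$2) (s$3), 0], vector [0, 0, 1]]))"
    (is "_ = _ * det ?Q")
proof -
  define T :: "real^6^6" where "T = vector [vector [1,0,0,0,0,0], vector [0,1,0,0,0,0], 
     vector [0,s$1,1,0,0,0], vector [-s$1,0,0,\<kappa>,0,0], vector [0,0,0,0,1,0], vector [0,0,0,0,0,\<epsilon>]]"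
  let ?p = "Transposition.transpose (2::6) 3"
  have "det T = \<kappa> * \<epsilon>"
  proof -
    have "\<forall>i j. i < j \<longrightarrow> T$i$j = 0"
      by (simp add: forall_6 T_def vector_6 less_bit0_def bit0.Rep_numeral bit0.Rep_1)
    then have "det T = prod (\<lambda>i. T$i$i) UNIV"
      by (intro det_lowerdiagonal) blast
    then show ?thesis
      by (simp add: prod_6 T_def vector_6)
  qed
  moreover have "vector [axis 1 1, acs \<kappa> s \<epsilon> (axis 1 1), axis 2 1, acs \<kappa> s \<epsilon> (axis 2 1),
      axis 5 1, acs \<kappa> s \<epsilon> (axis 5 1)] = (\<chi> i. T $ ?p i) ** ?Q"
    using \<kappa> by (auto simp: vec_eq_iff matrix_matrix_mult_def forall_6 sum_6 vector_6 T_def realify_def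
        acs_def acs_nth axis_def Transposition.transpose_def)
  moreover have "det (\<chi> i. T $ ?p i) = of_int (sign ?p) * det T"
    by (rule det_permute_rows) (simp add: permutes_swap_id)
  ultimately show ?thesis
    by (simp add: frame_det_def det_mul sign_swap_id)
qed

text \<open>The vectors \<open>e\<^sub>1, e\<^sub>2, e\<^sub>5\<close> form a complex frame unless \<open>J e\<^sub>1 = \<plusminus> e\<^sub>2\<close>, in which case
\<open>e\<^sub>1, e\<^sub>3, e\<^sub>5\<close> do. The determinant of either frame has the sign of \<open>- \<kappa> \<epsilon>\<close>.\<close>

lemma acs_positive_OCS:
  assumes s: "s \<in> sphere 0 1" and \<kappa>: "\<kappa> = 1 \<or> \<kappa> = -1" and \<epsilon>: "\<epsilon> = 1 \<or> \<epsilon> = -1"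
  shows "acs \<kappa> s \<epsilon> \<in> positive_OCS \<longleftrightarrow> \<kappa> * \<epsilon> = -1"
proof -
  note J = linear_acs acs_square[OF assms]
  have "\<exists>x y z. \<kappa> * \<epsilon> * frame_det (acs \<kappa> s \<epsilon>) x y z < 0"
  proof (cases "s$2 = 0 \<and> s$3 = 0")
    case True
    have "frame_det (acs \<kappa> s \<epsilon>) (axis 1 1) (axis 3 1) (axis 5 1) = - \<kappa> * \<epsilon> * (s$1)\<^sup>2"
    proof -
      have "vector [axis 1 1, acs \<kappa> s \<epsilon> (axis 1 1), axis 3 1, acs \<kappa> s \<epsilon> (axis 3 1),
        axis 5 1, acs \<kappa> s \<epsilon> (axis 5 1)] = (vector [vector [1,0,0,0,0,0], vector [0,s$1,0,0,0,0], 
     vector [0,0,1,0,0,0], vector [0,0,0,- \<kappa> * s$1,0,0], vector [0,0,0,0,1,0], vector [0,0,0,0,0,\<epsilon>]] :: real^6^6)"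
        (is "_ = ?T")
        using True by (simp add: vec_eq_iff forall_6 vector_6 acs_def acs_nth axis_def)
      moreover have "\<forall>i j. i \<noteq> j \<longrightarrow> ?T$i$j = 0"
        by (simp add: forall_6 vector_6)
      then have "det ?T = prod (\<lambda>i. ?T$i$i) UNIV"
        by (intro det_diagonal) blast
      ultimately show ?thesis
        by (simp add: frame_det_def prod_6 vector_6 power2_eq_square)
    qed
    moreover have "(s$1)\<^sup>2 = 1"
      using s[unfolded sphere_3] True by simp
    ultimately show ?thesis
      using \<kappa> \<epsilon> by (intro exI[of _ "axis 1 1"] exI[of _ "axis 3 1"] exI[of _ "axis 5 1"]) auto
  next
    case False
    define Q :: "complex^3^3"
      where "Q = vector [vector [1, 0, 0], vector [0, Complex (s$2) (s$3), 0], vector [0, 0, 1]]"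
    have "det Q = Complex (s$2) (s$3)"
      by (simp add: Q_def det_3)
    then have "det (realify Q) > 0"
      using det_realify_nz[of Q] det_realify_nonneg[of Q] False
      by (auto simp: invertible_det_nz complex_eq_iff)
    moreover have "\<kappa> * \<epsilon> * (- \<kappa> * \<epsilon> * d) = - d" for d
      using \<kappa> \<epsilon> by auto
    ultimately show ?thesis
      using acs_frame_det[OF \<kappa>, of s \<epsilon>] unfolding Q_def by (metis neg_less_0_iff_less)
  qed
  then obtain a b c where abc: "\<kappa> * \<epsilon> * frame_det (acs \<kappa> s \<epsilon>) a b c < 0" by blast
  have sign: "frame_det (acs \<kappa> s \<epsilon>) x y z * frame_det (acs \<kappa> s \<epsilon>) a b c \<ge> 0" for x y z
    by (rule frame_det_same_sign[OF J]) (use abc in auto)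
  have "(\<exists>x y z. frame_det (acs \<kappa> s \<epsilon>) x y z > 0) \<longleftrightarrow> \<kappa> * \<epsilon> = -1"
  proof
    assume "\<exists>x y z. frame_det (acs \<kappa> s \<epsilon>) x y z > 0"
    then have "frame_det (acs \<kappa> s \<epsilon>) a b c \<ge> 0"
      using sign by (metis zero_le_mult_iff not_less)
    with abc show "\<kappa> * \<epsilon> = -1"
      using \<kappa> \<epsilon> by auto
  next
    assume "\<kappa> * \<epsilon> = -1"
    with abc show "\<exists>x y z. frame_det (acs \<kappa> s \<epsilon>) x y z > 0" by auto
  qed
  then show ?thesis
    using acs_OCS[OF assms] by (simp add: positive_OCS_def frame_det_def)
qed

lemma OCS_basic:
  assumes "J \<in> OCS"
  shows "J x \<bullet> y = - (x \<bullet> J y)" "J x \<bullet> J y = x \<bullet> y" "J (J x) = - x" "linear J"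
proof -
  have "J x \<bullet> J y = x \<bullet> y" for x y
    using assms by (auto simp: OCS_def orthogonal_transformation_def)
  then show "J x \<bullet> J y = x \<bullet> y" .
  show "J (J x) = - x" "linear J"
    using assms by (auto simp: OCS_def orthogonal_transformation_def)
  have "J x \<bullet> J (J y) = x \<bullet> J y" by fact
  then show "J x \<bullet> y = - (x \<bullet> J y)"
    using assms by (simp add: OCS_def)
qed

text \<open>The last three hypotheses say that the cross product of \<open>(a, b, c)\<close> and \<open>(d, e, f)\<close> is zero.\<close>

lemma unit_vectors_parallel:
  fixes a b c d e f :: real
  assumes "a\<^sup>2 + b\<^sup>2 + c\<^sup>2 = 1" "d\<^sup>2 + e\<^sup>2 + f\<^sup>2 = 1"
    and "b * f = c * e" "c * d = a * f" "a * e = b * d"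
  shows "(d = a \<and> e = b \<and> f = c) \<or> (d = -a \<and> e = -b \<and> f = -c)"
proof -
  define k where "k = a * d + b * e + c * f"
  have "d = k * a" "e = k * b" "f = k * c"
    using assms unfolding k_def by algebra+
  moreover from this have "k\<^sup>2 = 1"
    using assms(1,2) by algebra
  ultimately show ?thesis
    by (auto simp: power2_eq_1_iff)
qed

lemma linear_axis_expansion:
  fixes J :: "real^'n \<Rightarrow> 'a::real_vector"
  assumes "linear J"
  shows "J x = (\<Sum>i\<in>UNIV. x$i *\<^sub>R J (axis i 1))"
proof -
  have "J x = J (\<Sum>i\<in>UNIV. x$i *s axis i 1)"
    by (simp only: basis_expansion)
  also have "\<dots> = (\<Sum>i\<in>UNIV. x$i *\<^sub>R J (axis i 1))"
    by (simp add: linear_sum[OF assms] linear_scale[OF assms] scalar_mult_eq_scaleR)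
  finally show ?thesis .
qed

text \<open>The matrix \<open>w\<close> of \<open>J\<close> on \<open>E\<close> is skew-symmetric and orthogonal. Orthogonality of its first row
to the others says that \<open>(w\<^sub>1\<^sub>2, w\<^sub>1\<^sub>3, w\<^sub>1\<^sub>4)\<close> is parallel to \<open>(w\<^sub>3\<^sub>4, - w\<^sub>2\<^sub>4, w\<^sub>2\<^sub>3)\<close>, and both are
unit vectors; the two signs are the self-dual and the anti-self-dual case.\<close>

lemma OCS_preserving_centre:
  assumes J: "J \<in> OCS" and \<epsilon>: "\<epsilon> = 1 \<or> \<epsilon> = -1" and e5: "J (axis 5 1) = \<epsilon> *\<^sub>R axis 6 1"
  shows "\<exists>\<kappa> s. (\<kappa> = 1 \<or> \<kappa> = -1) \<and> s \<in> sphere 0 1 \<and> J = acs \<kappa> s \<epsilon>"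
proof -
  define w where "w i j = J (axis i 1) $ j" for i j :: 6
  have w: "w i j = J (axis i 1) \<bullet> axis j 1" for i j
    by (simp add: w_def inner_axis)
  have skew: "w i j = - w j i" for i j
    unfolding w using OCS_basic(1)[OF J, of "axis i 1" "axis j 1"] by (simp add: inner_commute)
  have diag: "w i i = 0" for i
    using skew[of i i] by simp
  have w5: "w 5 j = \<epsilon> * axis 6 1 $ j" for j
    by (simp add: w_def e5)
  have "J (J (axis 5 1)) = \<epsilon> *\<^sub>R J (axis 6 1)"
    unfolding e5 by (simp add: linear_scale[OF OCS_basic(4)[OF J]])
  then have "J (axis 6 1) = - \<epsilon> *\<^sub>R axis 5 1"
    using \<epsilon> OCS_basic(3)[OF J, of "axis 5 1"] by (auto simp: minus_equation_iff)
  then have w6: "w 6 j = - \<epsilon> * axis 5 1 $ j" for j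
    by (simp add: w_def)
  have orth: "(\<Sum>k\<in>UNIV. w i k * w j k) = of_bool (i = j)" for i j
    using OCS_basic(2)[OF J, of "axis i 1" "axis j 1"]
    by (simp add: w_def inner_vec_def[of "J _"] inner_axis_axis)
  have z: "w i 5 = 0" "w i 6 = 0" if "i \<in> {1,2,3,4}" for i
    using skew[of i 5] skew[of i 6] w5[of i] w6[of i] that by (auto simp: axis_def)
  note sk = skew[of 2 1] skew[of 3 1] skew[of 4 1] skew[of 3 2] skew[of 4 2] skew[of 4 3]
  have o: "(w 1 2)\<^sup>2 + (w 1 3)\<^sup>2 + (w 1 4)\<^sup>2 = 1" "(w 1 2)\<^sup>2 + (w 2 3)\<^sup>2 + (w 2 4)\<^sup>2 = 1"
     "(w 1 3)\<^sup>2 + (w 2 3)\<^sup>2 + (w 3 4)\<^sup>2 = 1" "(w 1 4)\<^sup>2 + (w 2 4)\<^sup>2 + (w 3 4)\<^sup>2 = 1"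
    "w 1 3 * w 2 3 + w 1 4 * w 2 4 = 0" "w 1 4 * w 3 4 = w 1 2 * w 2 3"
    "w 1 2 * w 2 4 + w 1 3 * w 3 4 = 0"
    using orth[of 1 1] orth[of 2 2] orth[of 3 3] orth[of 4 4] orth[of 1 2] orth[of 1 3] orth[of 1 4]
    by (simp_all add: sum_6 z diag sk power2_eq_square)
  define s where "s = (vector [w 1 2, w 1 3, w 1 4] :: real^3)"
  have "(w 3 4 = w 1 2 \<and> - w 2 4 = w 1 3 \<and> w 2 3 = w 1 4) \<or>
        (w 3 4 = - w 1 2 \<and> - w 2 4 = - w 1 3 \<and> w 2 3 = - w 1 4)"
    by (rule unit_vectors_parallel) (use o in \<open>simp_all add: algebra_simps\<close>)
  then obtain \<kappa> where \<kappa>: "\<kappa> = 1 \<or> \<kappa> = -1"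
    "w 3 4 = - \<kappa> * w 1 2" "w 2 4 = \<kappa> * w 1 3" "w 2 3 = - \<kappa> * w 1 4"
    by (metis minus_minus mult_1 mult_minus1)
  have "s \<in> sphere 0 1"
    using o(1) by (simp only: sphere_3 s_def vector_3)
  moreover have "J = acs \<kappa> s \<epsilon>"
  proof
    fix x
    have J_nth: "J x $ j = (\<Sum>i\<in>UNIV. x$i * w i j)" for j
      by (subst linear_axis_expansion[OF OCS_basic(4)[OF J]]) (simp add: w_def)
    show "J x = acs \<kappa> s \<epsilon> x"
      unfolding vec_eq_iff forall_6 J_nth
      by (simp add: sum_6 diag sk z w5 w6 \<kappa>(2-4) acs_def acs_nth s_def axis_def
         algebra_simps)
  qed
  ultimately show ?thesis
    using \<kappa>(1) by blast
qed

section \<open>Integrable complex structures\<close>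

text \<open>The parameter of \<open>J\<^sub>0\<close> in the self-dual sphere.\<close>

abbreviation e1 :: "real^3" where "e1 \<equiv> axis 1 1"

lemma bracket_nth:
  "bracket u v $ 1 = 0" "bracket u v $ 2 = 0" "bracket u v $ 3 = 0" "bracket u v $ 4 = 0"
  "bracket u v $ 5 = (v$1 * u$3 - v$2 * u$4) - (u$1 * v$3 - u$2 * v$4)"
  "bracket u v $ 6 = (v$1 * u$4 + v$2 * u$3) - (u$1 * v$4 + u$2 * v$3)"
  by (simp_all add: bracket_eq vector_6)

lemma bracket_orthogonal_to_noncentral:
  "x$5 = 0 \<Longrightarrow> x$6 = 0 \<Longrightarrow> bracket u v \<bullet> x = 0"
  by (simp add: inner_6 bracket_nth)

text \<open>Let \<open>u = J e\<^sub>5\<close>. As \<open>e\<^sub>5\<close> is central, integrability reduces to \<open>[u, Jy] = J [u, y]\<close>. If \<open>u\<close> were not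
central, \<open>e\<^sub>5 = [u, y]\<close> for some \<open>y\<close>, and then \<open>u = J e\<^sub>5 = [u, Jy]\<close> would be central after all.\<close>

lemma W34_preserves_centre:
  assumes J: "J \<in> OCS" and int: "class_W34 J"
  shows "\<exists>\<epsilon>. (\<epsilon> = 1 \<or> \<epsilon> = -1) \<and> J (axis 5 1) = \<epsilon> *\<^sub>R axis 6 1"
proof -
  define u where "u = J (axis 5 1)"
  have central: "bracket (axis 5 1) y = 0" for y
    by (simp add: vec_eq_iff forall_6 bracket_nth axis_def)
  have "J 0 = 0" using OCS_basic(4)[OF J] by (rule linear_0)
  have commute: "bracket u (J y) = J (bracket u y)" for y
    using int[unfolded class_W34_def, rule_format, of "axis 5 1" y]
    by (simp add: nijenhuis_def central u_def \<open>J 0 = 0\<close>)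
  define r where "r = (u$1)\<^sup>2 + (u$2)\<^sup>2 + (u$3)\<^sup>2 + (u$4)\<^sup>2"
  have "r = 0"
  proof (rule ccontr)
    assume r: "r \<noteq> 0"
    \<comment> \<open>In the complex coordinates \<open>a = u\<^sub>1 + i u\<^sub>2\<close>, \<open>b = u\<^sub>3 + i u\<^sub>4\<close>, and likewise \<open>a', b'\<close> for \<open>y\<close>,
      the bracket is \<open>a' b - a b'\<close>; it becomes \<open>1\<close> for \<open>(a', b') = (cnj b, - cnj a) / r\<close>.\<close>
    define y where "y = (1 / r) *\<^sub>R (vector [u$3, - u$4, - u$1, u$2, 0, 0] :: real^6)"
    have "bracket u y = axis 5 1"
    proof -
      have "bracket u y = (1 / r) *\<^sub>R r *\<^sub>R axis 5 1"
        by (simp add: vec_eq_iff forall_6 bracket_nth vector_6 y_def axis_def r_def power2_eq_square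
            add_divide_distrib[symmetric] diff_divide_distrib[symmetric] algebra_simps)
      with r show ?thesis by simp
    qed
    with commute[of y] have "u = bracket u (J y)" by (simp add: u_def)
    then have "u$1 = 0" "u$2 = 0" "u$3 = 0" "u$4 = 0" by (metis bracket_nth)+
    then show False using r by (simp add: r_def)
  qed
  then have 0: "u$1 = 0" "u$2 = 0" "u$3 = 0" "u$4 = 0"
    unfolding r_def by (smt (verit) zero_le_power2 power2_eq_iff_nonneg power_zero_numeral zero_eq_power2)+
  have "u \<bullet> axis 5 1 = 0"
    using OCS_basic(1)[OF J, of "axis 5 1" "axis 5 1"] by (simp add: u_def inner_commute)
  then have 5: "u$5 = 0" by (simp add: inner_axis)
  have "u \<bullet> u = 1"
    using OCS_basic(2)[OF J, of "axis 5 1" "axis 5 1"] by (simp add: u_def inner_axis_axis)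
  then have "(u$6)\<^sup>2 = 1"
    by (simp add: inner_6 0 5 power2_eq_square)
  then have "u$6 = 1 \<or> u$6 = -1"
    by (simp add: power2_eq_1_iff)
  moreover have "u = u$6 *\<^sub>R axis 6 1"
    by (simp add: vec_eq_iff forall_6 0 5 axis_def)
  ultimately show ?thesis
    unfolding u_def by blast
qed

text \<open>The bracket takes its values in \<open>Z\<close> and its components are self-dual, hence of type \<open>(1,1)\<close> for an
anti-self-dual structure: \<open>[Jx, y] = - [x, Jy]\<close>. The terms of the Nijenhuis tensor then cancel in
pairs.\<close>

lemma antiselfdual_integrable:
  assumes "s \<in> sphere 0 1" "\<epsilon> = 1 \<or> \<epsilon> = -1"
  shows "class_W34 (acs 1 s \<epsilon>)"
proof -
  let ?J = "acs 1 s \<epsilon>"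
  have skew: "bracket (?J x) y = - bracket x (?J y)" for x y
    by (simp add: vec_eq_iff forall_6 bracket_nth acs_def acs_nth algebra_simps)
  have "?J (?J y) = - y" for y
    using assms by (intro acs_square) auto
  then have "bracket (?J x) (?J y) = bracket x y" for x y
    unfolding skew by (simp add: bilinear_rneg[OF bilinear_bracket])
  then show ?thesis
    by (simp add: class_W34_def nijenhuis_def skew linear_neg[OF linear_acs])
qed

lemma standard_integrable: "class_W34 (acs (-1) e1 1)"
  by (simp add: class_W34_def nijenhuis_def vec_eq_iff forall_6 bracket_nth acs_def acs_nth
      axis_def algebra_simps)

text \<open>The two components of the Nijenhuis tensor are \<open>(1 - s\<^sub>1)\<^sup>2 - s\<^sub>2\<^sup>2 + s\<^sub>3\<^sup>2\<close> and
\<open>(1 - s\<^sub>1)\<^sup>2 + s\<^sub>2\<^sup>2 - s\<^sub>3\<^sup>2\<close>; in their sum the sign-indefinite part disappears.\<close>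

lemma selfdual_integrable_imp_standard:
  assumes "class_W34 (acs (-1) s 1)" "s \<in> sphere 0 1"
  shows "s = e1"
proof -
  let ?N = "nijenhuis (acs (-1) s 1)"
  have "?N (axis 1 1) (axis 3 1) $ 5 + ?N (axis 1 1) (axis 4 1) $ 6 = 2 * (1 - s$1)\<^sup>2"
    by (simp add: nijenhuis_def bracket_nth acs_def acs_nth axis_def power2_eq_square algebra_simps)
  then have "s$1 = 1"
    using assms(1) by (simp add: class_W34_def)
  moreover from this have "(s$2)\<^sup>2 + (s$3)\<^sup>2 = 0"
    using assms(2)[unfolded sphere_3] by simp
  then have "s$2 = 0 \<and> s$3 = 0"
    by (simp add: sum_power2_eq_zero_iff)
  ultimately show ?thesis
    by (simp add: vec_eq_iff forall_3 axis_def)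
qed

lemma positive_W34_iff:
  "J \<in> positive_OCS \<and> class_W34 J \<longleftrightarrow> (\<exists>s\<in>sphere 0 1. J = acs 1 s (-1)) \<or> J = acs (-1) e1 1"
proof
  assume J: "J \<in> positive_OCS \<and> class_W34 J"
  then have "J \<in> OCS" by (simp add: positive_OCS_def)
  with J obtain \<epsilon> where \<epsilon>: "\<epsilon> = 1 \<or> \<epsilon> = -1" "J (axis 5 1) = \<epsilon> *\<^sub>R axis 6 1"
    using W34_preserves_centre by blast
  then obtain \<kappa> s where *: "\<kappa> = 1 \<or> \<kappa> = -1" "s \<in> sphere 0 1" "J = acs \<kappa> s \<epsilon>"
    using OCS_preserving_centre[OF \<open>J \<in> OCS\<close>] by blast
  then have "\<kappa> * \<epsilon> = -1"
    using J acs_positive_OCS \<epsilon>(1) by blast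
  with * \<epsilon>(1) have "\<kappa> = 1 \<and> \<epsilon> = -1 \<or> \<kappa> = -1 \<and> \<epsilon> = 1" by auto
  then show "(\<exists>s\<in>sphere 0 1. J = acs 1 s (-1)) \<or> J = acs (-1) e1 1"
  proof
    assume "\<kappa> = 1 \<and> \<epsilon> = -1"
    then show ?thesis using *(2,3) by auto
  next
    assume "\<kappa> = -1 \<and> \<epsilon> = 1"
    then show ?thesis using selfdual_integrable_imp_standard[OF _ *(2)] *(3) J by auto
  qed
next
  have "e1 \<in> sphere 0 1" by simp
  moreover assume "(\<exists>s\<in>sphere 0 1. J = acs 1 s (-1)) \<or> J = acs (-1) e1 1"
  ultimately show "J \<in> positive_OCS \<and> class_W34 J"
    using acs_positive_OCS antiselfdual_integrable standard_integrable by auto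
qed

section \<open>The torsion class of the product structure\<close>

lemma levi_civita_nabla: "levi_civita nabla"
  unfolding nabla_def by (rule theI'[OF ex1_levi_civita])

lemma tens_skew: "tens x y z - tens y x z = bracket x y \<bullet> z"
  using levi_civita_nabla by (metis levi_civita_def inner_diff_left tens_def)

lemma tens_metric: "tens x y z = - tens x z y"
  using levi_civita_nabla unfolding levi_civita_def tens_def
  by (metis add.inverse_unique inner_commute minus_equation_iff)

text \<open>Koszul's formula: the symmetric part of \<open>A\<close> or \<open>B\<close> is expressed by brackets with the third
argument.\<close>

lemma tens_symmetric: "tens x y z + tens y x z = bracket z x \<bullet> y + bracket z y \<bullet> x"
  using tens_skew[of z x y] tens_skew[of z y x] tens_metric[of x y z] tens_metric[of y x z]
    tens_metric[of z x y] by simp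

lemma trace_over_orthonormal:
  assumes "subspace W"
  obtains b where "pairwise orthogonal b" "\<And>x. x \<in> b \<Longrightarrow> norm x = 1" "span b = W" "finite b"
    "trace_over W = (\<lambda>q. \<Sum>x\<in>b. q x x)"
proof -
  define P where "P b \<longleftrightarrow> pairwise orthogonal b \<and> (\<forall>x\<in>b. norm x = 1) \<and> span b = W" for b
  define b where "b = (SOME b. P b)"
  have "\<exists>b. P b"
    unfolding P_def using orthonormal_basis_subspace[OF assms] by metis
  then have b: "P b"
    unfolding b_def by (rule someI_ex)
  then have "0 \<notin> b" unfolding P_def by (metis norm_zero zero_neq_one)
  then have "finite b"
    using b pairwise_orthogonal_independent independent_imp_finite unfolding P_def by blast
  moreover have "trace_over W = (\<lambda>q. \<Sum>x\<in>b. q x x)"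
    by (simp add: fun_eq_iff trace_over_def b_def P_def Let_def)
  ultimately show ?thesis
    using b that[of b] unfolding P_def by blast
qed

text \<open>Brackets lie in \<open>Z\<close> and are orthogonal to \<open>V\<close>, so by \<open>tens_symmetric\<close> the symmetric part of \<open>A\<close>
vanishes, and so does the skew part of \<open>B\<close>. The trace of \<open>B\<close> at \<open>v\<close> is the trace of \<open>ad v\<close> over
the complement of \<open>V\<close>, which contains \<open>Z\<close>; it is zero because \<open>ad v\<close> maps into \<open>Z\<close> and kills \<open>Z\<close>.\<close>

lemma noncentral_plane_class:
  assumes V: "subspace V" and noncentral: "\<And>x. x \<in> V \<Longrightarrow> x$5 = 0 \<and> x$6 = 0"
  shows "ops_class {V1, V5} V"
proof -
  have perp: "bracket u v \<bullet> x = 0" if "x \<in> V" for u v x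
    using noncentral[OF that] by (simp add: bracket_orthogonal_to_noncentral)
  have comp2: "orthogonal_comp (orthogonal_comp V) = V"
    using V by (rule orthogonal_comp_self)
  have traceV: "trace_over V (\<lambda>a b. tens a b z) = 0" for z
  proof -
    obtain b where b: "span b = V" "trace_over V = (\<lambda>q. \<Sum>x\<in>b. q x x)"
      using trace_over_orthonormal[OF V] by blast
    have "tens x x z = 0" if "x \<in> b" for x
      using tens_symmetric[of x x z] perp[of x] span_base[OF that] b(1) by simp
    then show ?thesis by (simp add: b(2))
  qed
  have traceH: "trace_over (orthogonal_comp V) (\<lambda>a b. tens a b v) = 0" for v
  proof -
    obtain b where b: "pairwise orthogonal b" "\<And>x. x \<in> b \<Longrightarrow> norm x = 1"
      "span b = orthogonal_comp V" "finite b"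
      and tr: "trace_over (orthogonal_comp V) = (\<lambda>q. \<Sum>x\<in>b. q x x)"
      using trace_over_orthonormal[OF subspace_orthogonal_comp[of V]] by blast
    have lin: "linear (bracket v)"
      using bilinear_bracket by (simp add: bilinear_def)
    have "(\<Sum>x\<in>b. bracket v x $ k * x $ k) = 0" if k: "k = 5 \<or> k = 6" for k
    proof -
      have "axis k 1 \<in> span b"
        using k noncentral by (auto simp: b(3) orthogonal_comp_def orthogonal_def inner_axis)
      \<comment> \<open>Expanding the central vector \<open>e\<^sub>k\<close> in the basis \<open>b\<close> turns the sum into \<open>[v, e\<^sub>k]\<^sub>k = 0\<close>.\<close>
      then have "(\<Sum>x\<in>b. (axis k 1 \<bullet> x) *\<^sub>R x) = axis k 1"
        by (intro orthonormal_basis_expand b)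
      then have "bracket v (\<Sum>x\<in>b. x$k *\<^sub>R x) = bracket v (axis k 1)"
        by (simp add: inner_axis')
      also have "\<dots> = 0"
        using k by (auto simp: vec_eq_iff forall_6 bracket_nth axis_def)
      finally have "(\<Sum>x\<in>b. x$k *\<^sub>R bracket v x) $ k = 0"
        by (simp add: linear_sum[OF lin] linear_scale[OF lin])
      then show ?thesis by (simp add: mult.commute)
    qed
    then have "(\<Sum>x\<in>b. bracket v x \<bullet> x) = 0"
      by (simp add: inner_6 bracket_nth(1-4) sum.distrib)
    moreover have "tens x x v = bracket v x \<bullet> x" for x
      using tens_symmetric[of x x v] by simp
    ultimately show ?thesis by (simp add: tr)
  qed
  show ?thesis
    unfolding ops_class_def
  proof (intro allI impI ballI)
    fix m x y z
    assume m: "m \<notin> {V1, V5}" and xyz: "x \<in> first_factor V m" "y \<in> first_factor V m"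
      "z \<in> orthogonal_comp (first_factor V m)"
    from m consider "m = V2" | "m = V3" | "m = V4" | "m = V6" by (cases m) auto
    then show "torsion_component V m x y z = 0"
    proof cases
      case 1
      then show ?thesis
        using xyz perp by (simp add: tracefree_part_def trace_part_def traceV tens_symmetric)
    next
      case 3
      then show ?thesis
        using xyz perp by (simp add: skew_part_def tens_skew comp2)
    qed (simp_all add: trace_part_def traceV traceH)
  qed
qed

lemma span_pair: "x \<in> span {v, w} \<longleftrightarrow> (\<exists>a b. x = a *\<^sub>R v + b *\<^sub>R w)"
  by (auto simp: span_insert span_singleton algebra_simps; metis)

text \<open>If \<open>v\<close> has a nonzero \<open>Z\<close>-part, then so does \<open>Jv\<close>, and the \<open>Z\<close>-parts of \<open>v\<close> and \<open>Jv\<close> span \<open>Z\<close>.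
So every vector of \<open>E\<close> can be corrected by a central vector to become orthogonal to \<open>V\<close>. Applied
to \<open>e\<^sub>1\<close> and \<open>e\<^sub>3\<close>, this yields two vectors of the complement whose bracket is \<open>- e\<^sub>5\<close>; but if the
\<open>\<V>\<^sub>4\<close>-component vanishes, that bracket is orthogonal to \<open>v\<close> and \<open>Jv\<close>, hence zero.\<close>

lemma V4_zero_imp_noncentral:
  assumes cls: "ops_class I (span {v, acs \<kappa> s \<epsilon> v})" and I: "V4 \<notin> I" and \<epsilon>: "\<epsilon> = 1 \<or> \<epsilon> = -1"
  shows "v$5 = 0 \<and> v$6 = 0"
proof (rule ccontr)
  assume not_noncentral: "\<not> (v$5 = 0 \<and> v$6 = 0)"
  define r where "r = (v$5)\<^sup>2 + (v$6)\<^sup>2"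
  then have r: "r \<noteq> 0"
    using not_noncentral by (simp add: sum_power2_eq_zero_iff)
  let ?J = "acs \<kappa> s \<epsilon>"
  let ?V = "span {v, ?J v}"
  have comp: "h \<in> orthogonal_comp ?V" if "v \<bullet> h = 0" "?J v \<bullet> h = 0" for h
    unfolding orthogonal_comp_def using that
    by (auto simp: span_pair orthogonal_def inner_add_left)
  have lift: "\<exists>h \<in> orthogonal_comp ?V. h$1 = p$1 \<and> h$2 = p$2 \<and> h$3 = p$3 \<and> h$4 = p$4"
    if "p$5 = 0" "p$6 = 0" for p :: "real^6"
  proof -
    define a b where "a = - (v \<bullet> p)" and "b = - (?J v \<bullet> p)"
    \<comment> \<open>The central correction solves two linear equations with matrix rows \<open>(v\<^sub>5, v\<^sub>6)\<close> and
      \<open>\<epsilon> (- v\<^sub>6, v\<^sub>5)\<close>, which is orthogonal up to the factor \<open>r\<close>.\<close>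
    define h where "h = p + (1 / r) *\<^sub>R vector [0, 0, 0, 0, a * v$5 - \<epsilon> * b * v$6, a * v$6 + \<epsilon> * b * v$5]"
    have "v \<bullet> h = - a + (1 / r) * (a * r)"
      by (simp add: h_def inner_add_right a_def inner_6 vector_6 r_def power2_eq_square algebra_simps
        add_divide_distrib[symmetric] diff_divide_distrib[symmetric])
    moreover have "?J v \<bullet> h = - b + (1 / r) * (b * r)"
      using \<epsilon> by (auto simp: h_def inner_add_right b_def inner_6 vector_6 r_def power2_eq_square
        algebra_simps acs_def acs_nth add_divide_distrib[symmetric] diff_divide_distrib[symmetric])
    ultimately have "h \<in> orthogonal_comp ?V"
      using r by (intro comp) simp_all
    then show ?thesis
      by (rule bexI[rotated]) (simp add: h_def vector_6)
  qed
  obtain h where h: "h \<in> orthogonal_comp ?V" "h$1 = 1" "h$2 = 0" "h$3 = 0" "h$4 = 0"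
    using lift[of "axis 1 1"] by (auto simp: axis_def)
  obtain k where k: "k \<in> orthogonal_comp ?V" "k$1 = 0" "k$2 = 0" "k$3 = 1" "k$4 = 0"
    using lift[of "axis 3 1"] by (auto simp: axis_def)
  have "bracket h k \<bullet> z = 0" if "z \<in> ?V" for z
  proof -
    have "z \<in> orthogonal_comp (orthogonal_comp ?V)"
      using that orthogonal_comp_subset[of ?V] by (rule subsetD[rotated])
    then have "skew_part h k z = 0"
      using cls[unfolded ops_class_def, rule_format, of V4 h k z] I h(1) k(1) by simp
    then show ?thesis by (simp add: skew_part_def tens_skew)
  qed
  then have "bracket h k \<bullet> v = 0" "bracket h k \<bullet> ?J v = 0"
    by (simp_all add: span_base)
  then show False
    using \<epsilon> r by (auto simp: inner_6 bracket_nth h k acs_def acs_nth r_def)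
qed

section \<open>Mixed structures\<close>

text \<open>On a \<open>J\<close>-invariant plane the area form is \<open>(x, y) \<mapsto> Jx \<bullet> y\<close>, and it is positive on \<open>(v, Jv)\<close>.
So the orientation consistent with \<open>J\<close> consists of the pairs with positive area and is determined
by \<open>J\<close> and the plane.\<close>

lemma mixed_structures_iff:
  "(J, V, pos) \<in> mixed_structures \<longleftrightarrow>
     J \<in> positive_OCS \<and> (\<exists>v. norm v = 1 \<and> V = span {v, J v}) \<and>
     pos = {(x, y). x \<in> V \<and> y \<in> V \<and> J x \<bullet> y > 0}"
  (is "?L \<longleftrightarrow> ?R")
proof (cases "J \<in> positive_OCS")
  case False
  then show ?thesis by (auto simp: mixed_structures_def)
next
  case True
  then have J: "J \<in> OCS" by (simp add: positive_OCS_def)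
  note lin = OCS_basic(4)[OF J]
  have J0: "J x \<bullet> x = 0" for x
    using OCS_basic(1)[OF J, of x x] by (simp add: inner_commute)
  have area: "J (a *\<^sub>R v + b *\<^sub>R w) \<bullet> (c *\<^sub>R v + d *\<^sub>R w) = (a * d - b * c) * (J v \<bullet> w)" for a b c d v w
    using OCS_basic(1)[OF J, of w v]
    by (simp add: linear_add[OF lin] linear_scale[OF lin] inner_add_left inner_add_right J0
        inner_commute[of v] inner_commute[of w "J v"] algebra_simps)
  have pos_eq: "{(a *\<^sub>R v + b *\<^sub>R w, c *\<^sub>R v + d *\<^sub>R w) | a b c d. a * d - b * c > 0} =
      {(x, y). x \<in> span {v, w} \<and> y \<in> span {v, w} \<and> J x \<bullet> y > 0}" (is "?A = ?B")
    if "J v \<bullet> w > 0" for v w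
  proof -
    have "J (a *\<^sub>R v + b *\<^sub>R w) \<bullet> (c *\<^sub>R v + d *\<^sub>R w) > 0 \<longleftrightarrow> a * d - b * c > 0" for a b c d
      unfolding area using that by (simp add: zero_less_mult_iff)
    then show ?thesis
      unfolding span_pair by blast
  qed
  have basis: "v \<noteq> J v" "independent {v, J v}" if "v \<noteq> 0" for v
  proof -
    show "v \<noteq> J v"
      using J0[of v] that by auto
    have "J v \<noteq> 0" using OCS_basic(3)[OF J, of v] that by (metis linear_0[OF lin] neg_equal_0_iff_equal)
    then show "independent {v, J v}"
      using that J0[of v] by (intro pairwise_orthogonal_independent)
        (auto simp: pairwise_def orthogonal_def inner_commute)
  qed
  show ?thesis
  proof
    assume ?L
    then obtain v w where VP: "V = span {v, w}" "v \<noteq> w" "independent {v, w}"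
      "pos = {(a *\<^sub>R v + b *\<^sub>R w, c *\<^sub>R v + d *\<^sub>R w) | a b c d. a * d - b * c > 0}"
      and JV: "J ` V \<subseteq> V" and con: "\<And>v. v \<in> V \<Longrightarrow> v \<noteq> 0 \<Longrightarrow> (v, J v) \<in> pos"
      unfolding mixed_structures_def oriented_planes_def by auto
    have v: "v \<in> V" "v \<noteq> 0"
      using VP dependent_zero by (auto intro: span_base)
    obtain a b c d where abcd: "v = a *\<^sub>R v + b *\<^sub>R w" "J v = c *\<^sub>R v + d *\<^sub>R w" "a * d - b * c > 0"
      using con[OF v] unfolding VP(4) by auto
    have "(a * d - b * c) * (J v \<bullet> w) = J v \<bullet> J v"
      using area[of a v b w c d] abcd(1,2) by simp
    also have "\<dots> > 0"
      using v by (simp add: OCS_basic(2)[OF J])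
    finally have "J v \<bullet> w > 0"
      using abcd(3) by (simp add: zero_less_mult_iff)
    then have pos: "pos = {(x, y). x \<in> V \<and> y \<in> V \<and> J x \<bullet> y > 0}"
      unfolding VP(4) VP(1) by (rule pos_eq)
    define u where "u = v /\<^sub>R norm v"
    have u: "norm u = 1" "u \<in> V" "u \<noteq> 0"
      using v VP(1) by (auto simp: u_def span_scale)
    have "{u, J u} \<subseteq> V" using u JV by auto
    moreover have "dim V = card {u, J u}"
      using VP basis[OF u(3)] by (simp add: dim_eq_card_independent)
    ultimately have "V = span {u, J u}"
      using card_eq_dim[of "{u, J u}" V] basis[OF u(3)] VP(1)
      by (metis card.infinite card_eq_dim dim_span independent_imp_finite span_eq_iff span_span span_subspace subspace_span)
    with u pos True show ?R by blast
  next
    assume R: ?R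
    then obtain v where v: "norm v = 1" "V = span {v, J v}" 
      and pos: "pos = {(x, y). x \<in> V \<and> y \<in> V \<and> J x \<bullet> y > 0}" by blast
    have v0: "v \<noteq> 0" using v by auto
    then have "J v \<bullet> J v > 0" by (simp add: OCS_basic(2)[OF J])
    then have "(V, pos) \<in> oriented_planes"
      unfolding oriented_planes_def using pos_eq[of v "J v"] basis[OF v0] v(2) pos by blast
    moreover have "J ` V \<subseteq> V"
    proof -
      have "J (a *\<^sub>R v + b *\<^sub>R J v) = (- b) *\<^sub>R v + a *\<^sub>R J v" for a b
        by (simp add: linear_add[OF lin] linear_scale[OF lin] OCS_basic(3)[OF J])
      then show ?thesis
        unfolding v(2) by (auto simp only: span_pair image_subset_iff) blast
    qed
    moreover have "(x, J x) \<in> pos" if "x \<in> V" "x \<noteq> 0" for x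
      using that \<open>J ` V \<subseteq> V\<close> by (auto simp: pos OCS_basic(2)[OF J])
    ultimately show ?L
      using True by (auto simp: mixed_structures_def)
  qed
qed

section \<open>The planes and their 2-forms\<close>

text \<open>The oriented plane in \<open>E\<close> on which the quarter turns given by \<open>s\<close> (anti-self-dual) and \<open>t\<close>
(self-dual) agree; on its complement in \<open>E\<close> they are opposite.\<close>

definition plane :: "real^3 \<Rightarrow> real^3 \<Rightarrow> (real^6) set" where
  "plane s t = {x. x$5 = 0 \<and> x$6 = 0 \<and> quat 1 s x = quat (-1) t x}"

lemma quat_quat:
  assumes "\<kappa> = 1 \<or> \<kappa> = -1" "x$5 = 0" "x$6 = 0" "s \<in> sphere 0 1"
  shows "quat \<kappa> s (quat \<kappa> s x) = - x"
proof -
  have "acs \<kappa> s 1 (acs \<kappa> s 1 x) = - x"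
    using assms by (intro acs_square) auto
  moreover have "rot56 x = 0" "rot56 (quat \<kappa> s x) = 0"
    using assms(2,3) by (simp_all add: vec_eq_iff forall_6 acs_nth)
  ultimately show ?thesis by (simp add: acs_def)
qed

lemma quat_commute: "quat 1 s (quat (-1) t x) = quat (-1) t (quat 1 s x)"
  by (simp add: vec_eq_iff forall_6 quat_nth algebra_simps)

lemma linear_quat: "linear (quat \<kappa> s)"
  by (rule linearI; simp add: vec_eq_iff forall_6 acs_nth algebra_simps)

lemma quat_norm:
  assumes "\<kappa> = 1 \<or> \<kappa> = -1" "x$5 = 0" "x$6 = 0"
  shows "quat \<kappa> s x \<bullet> quat \<kappa> s x = (s \<bullet> s) * (x \<bullet> x)"
  using assms by (auto simp: inner_6 acs_nth inner_vec_def[of s] sum_3 algebra_simps)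

text \<open>For a unit vector \<open>v\<close> of \<open>E\<close>, the coordinates of \<open>w\<close> along the orthonormal vectors obtained from
\<open>v\<close> by the three imaginary units.\<close>

definition quat_coeff :: "real \<Rightarrow> real^6 \<Rightarrow> real^6 \<Rightarrow> real^3" where
  "quat_coeff \<kappa> v w = (\<chi> k. quat \<kappa> (axis k 1) v \<bullet> w)"

lemma quat_coeff_nth: "quat_coeff \<kappa> v w $ k = quat \<kappa> (axis k 1) v \<bullet> w"
  by (simp add: quat_coeff_def)

lemma quat_coeff_quat:
  assumes "\<kappa> = 1 \<or> \<kappa> = -1" "v$5 = 0" "v$6 = 0"
  shows "quat_coeff \<kappa> v (quat \<kappa> s v) = (v \<bullet> v) *\<^sub>R s"
  using assms
  by (auto simp: vec_eq_iff forall_3 quat_coeff_nth inner_6 quat_nth axis_def algebra_simps)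

lemma quat_quat_coeff:
  assumes "\<kappa> = 1 \<or> \<kappa> = -1" "v$5 = 0" "v$6 = 0" "w$5 = 0" "w$6 = 0"
  shows "quat \<kappa> (quat_coeff \<kappa> v w) v = (v \<bullet> v) *\<^sub>R w - (v \<bullet> w) *\<^sub>R v"
  using assms
  by (auto simp: vec_eq_iff forall_6 quat_coeff_nth inner_6 quat_nth axis_def algebra_simps)

text \<open>Together with \<open>v\<close> itself, the images of \<open>v\<close> under the three imaginary units form an orthonormal
basis of \<open>E\<close>, and \<open>w\<close> has no component along \<open>v\<close>.\<close>

lemma quat_transitive:
  assumes \<kappa>: "\<kappa> = 1 \<or> \<kappa> = -1" and E: "v$5 = 0" "v$6 = 0" "w$5 = 0" "w$6 = 0"
    and "norm v = 1" "norm w = 1" "v \<bullet> w = 0"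
  shows "\<exists>s\<in>sphere 0 1. quat \<kappa> s v = w"
proof
  let ?s = "quat_coeff \<kappa> v w"
  show *: "quat \<kappa> ?s v = w"
    using quat_quat_coeff[OF \<kappa> E] assms(6-8) by (simp add: norm_eq_1)
  show "?s \<in> sphere 0 1"
    using quat_norm[OF \<kappa> E(1,2), of ?s] assms(6,7) by (simp add: * norm_eq_1)
qed

lemma fundamental_form_nth: "fundamental_form J $ i $ j = J (axis i 1) $ j"
  by (simp add: fundamental_form_def inner_axis)

lemma fundamental_form_mult:
  assumes "linear J"
  shows "x v* fundamental_form J = J x"
  unfolding linear_axis_expansion[OF assms, of x]
  by (simp add: vec_eq_iff vector_matrix_mult_def fundamental_form_nth mult.commute)

lemma vector_matrix_mult_scaleR_right: "x v* (c *\<^sub>R A) = c *\<^sub>R (x v* A)" for A :: "real^'n^'m"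
  by (simp add: vec_eq_iff vector_matrix_mult_def sum_distrib_left algebra_simps)

lemma wedge_mult: "x v* wedge v w = (x \<bullet> v) *\<^sub>R w - (x \<bullet> w) *\<^sub>R v"
  by (simp add: vec_eq_iff vector_matrix_mult_def wedge_def inner_vec_def sum_distrib_left
      sum_distrib_right sum_subtractf algebra_simps)

text \<open>The three anti-self-dual and the three self-dual basic forms are an orthogonal basis of
\<open>\<Lambda>\<^sup>2 E\<close>, and \<open>quat_coeff\<close> gives the inner products with them.\<close>

lemma wedge_quat:
  assumes "v$5 = 0" "v$6 = 0" "w$5 = 0" "w$6 = 0"
  shows "wedge v w = (1/2) *\<^sub>R (fundamental_form (quat 1 (quat_coeff 1 v w))
    + fundamental_form (quat (-1) (quat_coeff (-1) v w)))"
proof -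
  have "2 *\<^sub>R wedge v w = fundamental_form (quat 1 (quat_coeff 1 v w))
    + fundamental_form (quat (-1) (quat_coeff (-1) v w))"
    using assms
    by (simp add: vec_eq_iff forall_6 fundamental_form_nth wedge_def quat_coeff_nth inner_6 quat_nth
        axis_def algebra_simps)
  from this[symmetric] show ?thesis by simp
qed

lemma subspace_plane: "subspace (plane s t)"
  by (rule subspaceI)
    (simp_all add: plane_def linear_0[OF linear_quat] linear_add[OF linear_quat]
      linear_scale[OF linear_quat])

lemma plane_wedge:
  assumes v: "v \<in> plane s t" "norm v = 1"
  shows "wedge v (quat 1 s v)
    = (1/2) *\<^sub>R (fundamental_form (quat 1 s) + fundamental_form (quat (-1) t))"
proof -
  have E: "v$5 = 0" "v$6 = 0" and eq: "quat 1 s v = quat (-1) t v"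
    using v(1) by (auto simp: plane_def)
  have "quat_coeff 1 v (quat 1 s v) = s" "quat_coeff (-1) v (quat 1 s v) = t"
    using quat_coeff_quat[of 1 v s] quat_coeff_quat[of "-1" v t] E v(2)
    by (simp_all add: eq norm_eq_1)
  then show ?thesis
    using wedge_quat[of v "quat 1 s v"] E by (simp add: quat_nth)
qed

text \<open>As \<open>I\<^sub>s\<close> and \<open>B\<^sub>t\<close> commute, \<open>- I\<^sub>s B\<^sub>t\<close> is an involution of \<open>E\<close>, whose fixed space is the plane and
contains the image of \<open>P = 1 - I\<^sub>s B\<^sub>t\<close>. The trace of \<open>I\<^sub>s B\<^sub>t\<close> is zero, hence that of \<open>P\<close> is \<open>4\<close>
and \<open>P \<noteq> 0\<close>.\<close>

lemma plane_unit_vector: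
  assumes s: "s \<in> sphere 0 1" and t: "t \<in> sphere 0 1"
  shows "\<exists>v\<in>plane s t. norm v = 1"
proof -
  define P where "P x = x - quat 1 s (quat (-1) t x)" for x
  have P: "P x \<in> plane s t" if "x$5 = 0" "x$6 = 0" for x
  proof -
    have "quat 1 s (P x) = quat 1 s x + quat (-1) t x"
      using s by (simp add: P_def linear_diff[OF linear_quat] quat_quat quat_nth)
    moreover have "quat (-1) t (P x) = quat (-1) t x + quat 1 s x"
      using that t by (simp add: P_def linear_diff[OF linear_quat] quat_commute[symmetric] quat_quat
          linear_neg[OF linear_quat])
    ultimately show ?thesis
      using that by (simp add: plane_def P_def quat_nth)
  qed
  have "\<exists>v\<in>plane s t. v \<noteq> 0"
  proof (rule ccontr)
    assume "\<not> ?thesis"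
    then have 0: "P x = 0" if "x$5 = 0" "x$6 = 0" for x using P that by blast
    have "P (axis 1 1) $ 1 + P (axis 2 1) $ 2 + P (axis 3 1) $ 3 + P (axis 4 1) $ 4 = 4"
      by (simp add: P_def quat_nth axis_def algebra_simps)
    then show False
      by (simp add: 0 axis_def)
  qed
  then obtain v where "v \<in> plane s t" "v \<noteq> 0" by blast
  then have "v /\<^sub>R norm v \<in> plane s t" "norm (v /\<^sub>R norm v) = 1"
    using subspace_plane by (auto intro: subspace_scale)
  then show ?thesis by blast
qed

text \<open>For \<open>x\<close> in the plane, contract \<open>plane_wedge\<close> with \<open>x\<close>: the right-hand side becomes \<open>I\<^sub>s x\<close>, the
left-hand side a combination of \<open>v\<close> and \<open>I\<^sub>s v\<close>.\<close>

lemma plane_eq_span: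
  assumes s: "s \<in> sphere 0 1" and t: "t \<in> sphere 0 1" and v: "v \<in> plane s t" "norm v = 1"
  shows "plane s t = span {v, quat 1 s v}"
proof
  have E: "x$5 = 0" "x$6 = 0" and eq: "quat 1 s x = quat (-1) t x" if "x \<in> plane s t" for x
    using that by (auto simp: plane_def)
  have sq: "quat 1 s (quat 1 s x) = - x" if "x \<in> plane s t" for x
    using E[OF that] s by (intro quat_quat) auto
  have "quat (-1) t (quat 1 s v) = - v"
    unfolding eq[OF v(1)] using E[OF v(1)] t by (intro quat_quat) auto
  then have "quat 1 s v \<in> plane s t"
    using sq[OF v(1)] by (simp add: plane_def quat_nth)
  then show "span {v, quat 1 s v} \<subseteq> plane s t"
    using v(1) by (intro span_minimal subspace_plane) auto
  show "plane s t \<subseteq> span {v, quat 1 s v}"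
  proof
    fix x assume x: "x \<in> plane s t"
    let ?w = "quat 1 s v"
    have "(x \<bullet> v) *\<^sub>R ?w - (x \<bullet> ?w) *\<^sub>R v = x v* wedge v ?w"
      by (simp add: wedge_mult)
    also have "\<dots> = (1/2) *\<^sub>R (quat 1 s x + quat (-1) t x)"
      by (simp add: plane_wedge[OF v] vector_matrix_mult_add_rdistrib vector_matrix_mult_scaleR_right
          fundamental_form_mult[OF linear_quat])
    also have "\<dots> = quat 1 s x"
      by (simp add: eq[OF x] scaleR_2[symmetric])
    finally have "quat 1 s (quat 1 s x) = quat 1 s ((x \<bullet> v) *\<^sub>R ?w - (x \<bullet> ?w) *\<^sub>R v)"
      by simp
    then have "- x = - ((x \<bullet> v) *\<^sub>R v) - (x \<bullet> ?w) *\<^sub>R ?w"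
      by (simp add: sq[OF x] sq[OF v(1)] linear_diff[OF linear_quat] linear_scale[OF linear_quat])
    then have "- (- ((x \<bullet> v) *\<^sub>R v) - (x \<bullet> ?w) *\<^sub>R ?w) = x"
      by (rule minus_equation_iff[THEN iffD1])
    then have "x = (x \<bullet> v) *\<^sub>R v + (x \<bullet> ?w) *\<^sub>R ?w"
      by (simp only: minus_diff_eq diff_minus_eq_add add.commute)
    then show "x \<in> span {v, ?w}"
      unfolding span_pair by blast
  qed
qed

section \<open>The structures in the torsion class and their 2-forms\<close>

definition oriented_by :: "(real^6 \<Rightarrow> real^6) \<Rightarrow> (real^6) set \<Rightarrow> mixed_structure" where
  "oriented_by J V = (J, V, {(x, y). x \<in> V \<and> y \<in> V \<and> J x \<bullet> y > 0})"

definition minus_structure :: "(real^3) \<times> (real^3) \<Rightarrow> mixed_structure" where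
  "minus_structure = (\<lambda>(s, t). oriented_by (acs 1 s (-1)) (plane s t))"

definition plus_structure :: "real^3 \<Rightarrow> mixed_structure" where
  "plus_structure s = oriented_by (acs (-1) e1 1) (plane s e1)"

lemma acs_noncentral: "x$5 = 0 \<Longrightarrow> x$6 = 0 \<Longrightarrow> acs \<kappa> s \<epsilon> x = quat \<kappa> s x"
  by (simp add: acs_def vec_eq_iff forall_6 acs_nth)

lemma acs_plane:
  "x \<in> plane s t \<Longrightarrow> acs 1 s \<epsilon> x = quat 1 s x" "x \<in> plane s t \<Longrightarrow> acs (-1) t \<epsilon> x = quat 1 s x"
  by (simp_all add: plane_def acs_noncentral)

text \<open>Stated for any \<open>J\<close> that agrees with \<open>I\<^sub>s = B\<^sub>t\<close> on the plane, so that it applies to \<open>J = I\<^sub>s\<close> and to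
\<open>J = B\<^sub>t\<close> on \<open>E\<close>.\<close>

lemma oriented_by_plane_in_class:
  assumes s: "s \<in> sphere 0 1" and t: "t \<in> sphere 0 1"
    and J: "J \<in> positive_OCS" "class_W34 J" "\<And>x. x \<in> plane s t \<Longrightarrow> J x = quat 1 s x"
  shows "oriented_by J (plane s t) \<in> W34_V15_structures"
proof -
  obtain v where v: "v \<in> plane s t" "norm v = 1"
    using plane_unit_vector[OF s t] by blast
  then have "plane s t = span {v, J v}"
    using plane_eq_span[OF s t v] J(3) by simp
  then have "oriented_by J (plane s t) \<in> mixed_structures"
    unfolding oriented_by_def mixed_structures_iff using J(1) v(2) by blast
  moreover have "ops_class {V1, V5} (plane s t)"
    by (rule noncentral_plane_class[OF subspace_plane]) (simp add: plane_def)
  ultimately show ?thesis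
    using J(2) by (simp add: W34_V15_structures_def oriented_by_def)
qed

lemma ms_form_oriented_by:
  assumes s: "s \<in> sphere 0 1" and t: "t \<in> sphere 0 1"
    and J: "\<And>x. x \<in> plane s t \<Longrightarrow> J x = quat 1 s x"
  shows "ms_form \<alpha> (oriented_by J (plane s t)) = fundamental_form J
    + (\<alpha>/2) *\<^sub>R (fundamental_form (quat 1 s) + fundamental_form (quat (-1) t))"
    (is "_ = ?\<sigma>")
proof -
  have *: "fundamental_form J + \<alpha> *\<^sub>R wedge v (J v) = ?\<sigma>" if "v \<in> plane s t" "norm v = 1" for v
    using plane_wedge[OF that] J[OF that(1)] by simp
  obtain v where v: "v \<in> plane s t" "norm v = 1"
    using plane_unit_vector[OF s t] by blast
  have "(\<exists>v\<in>plane s t. norm v = 1 \<and> \<sigma> = fundamental_form J + \<alpha> *\<^sub>R wedge v (J v)) \<longleftrightarrow> \<sigma> = ?\<sigma>" for \<sigma>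
  proof
    assume "\<exists>v\<in>plane s t. norm v = 1 \<and> \<sigma> = fundamental_form J + \<alpha> *\<^sub>R wedge v (J v)"
    then obtain v where "v \<in> plane s t" "norm v = 1" "\<sigma> = fundamental_form J + \<alpha> *\<^sub>R wedge v (J v)"
      by blast
    then show "\<sigma> = ?\<sigma>" by (simp only: *)
  next
    assume "\<sigma> = ?\<sigma>"
    then have "\<sigma> = fundamental_form J + \<alpha> *\<^sub>R wedge v (J v)" by (simp only: *[OF v])
    with v show "\<exists>v\<in>plane s t. norm v = 1 \<and> \<sigma> = fundamental_form J + \<alpha> *\<^sub>R wedge v (J v)"
      by blast
  qed
  then show ?thesis
    by (simp only: ms_form_def oriented_by_def prod.case the_eq_trivial)
qed

text \<open>Given \<open>(J, V)\<close> in the class and a unit vector \<open>v\<close> of \<open>V \<subseteq> E\<close>, one of the two parameters is read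
off from \<open>J\<close>, and transitivity supplies the other one as the structure of the opposite duality that
takes \<open>v\<close> to \<open>Jv\<close>.\<close>

lemma W34_V15_structures_eq:
  "W34_V15_structures = minus_structure ` (sphere 0 1 \<times> sphere 0 1) \<union> plus_structure ` sphere 0 1"
proof (rule set_eqI, rule iffI)
  have e1: "e1 \<in> sphere 0 1" by simp
  fix X
  {
    assume "X \<in> minus_structure ` (sphere 0 1 \<times> sphere 0 1) \<union> plus_structure ` sphere 0 1"
    then consider s t where "s \<in> sphere 0 1" "t \<in> sphere 0 1" "X = minus_structure (s, t)"
      | s where "s \<in> sphere 0 1" "X = plus_structure s" by blast
    then show "X \<in> W34_V15_structures"
    proof cases
      case 1
      then have "acs 1 s (-1) \<in> positive_OCS \<and> class_W34 (acs 1 s (-1))"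
        unfolding positive_W34_iff by blast
      with 1 show ?thesis
        unfolding 1 minus_structure_def prod.case by (intro oriented_by_plane_in_class) (auto simp: acs_plane)
    next
      case 2
      have "acs (-1) e1 1 \<in> positive_OCS \<and> class_W34 (acs (-1) e1 1)"
        unfolding positive_W34_iff by blast
      with 2 e1 show ?thesis
        unfolding 2 plus_structure_def by (intro oriented_by_plane_in_class) (auto simp: acs_plane)
    qed
  next
    assume "X \<in> W34_V15_structures"
    then obtain J V pos where X: "X = (J, V, pos)" and mixed: "(J, V, pos) \<in> mixed_structures"
      and W: "class_W34 J" and ops: "ops_class {V1, V5} V"
      unfolding W34_V15_structures_def by blast
    then obtain v where J: "J \<in> positive_OCS" and v: "norm v = 1" "V = span {v, J v}"
      and pos: "X = oriented_by J V"
      unfolding mixed_structures_iff oriented_by_def by blast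
    have classified: "(\<exists>s\<in>sphere 0 1. J = acs 1 s (-1)) \<or> J = acs (-1) e1 1"
      using J W positive_W34_iff by blast
    then obtain \<kappa> r \<epsilon> where acs: "J = acs \<kappa> r \<epsilon>" "\<kappa> = 1 \<or> \<kappa> = -1" "\<epsilon> = 1 \<or> \<epsilon> = -1" "r \<in> sphere 0 1"
      using e1 by blast
    have E: "v$5 = 0" "v$6 = 0"
      using V4_zero_imp_noncentral[of "{V1, V5}" v \<kappa> r \<epsilon>] ops acs v(2) by auto
    have "norm (J v) = 1" "v \<bullet> J v = 0"
      using OCS_basic(1,2)[of J v v] J v(1) by (auto simp: positive_OCS_def norm_eq_1 inner_commute)
    moreover have "J v $ 5 = 0" "J v $ 6 = 0"
      unfolding acs(1) acs_noncentral[OF E] by (simp_all add: quat_nth)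
    ultimately have transitive: "\<exists>t\<in>sphere 0 1. quat \<tau> t v = J v" if "\<tau> = 1 \<or> \<tau> = -1" for \<tau>
      using quat_transitive[OF that E _ _ v(1)] by blast
    show "X \<in> minus_structure ` (sphere 0 1 \<times> sphere 0 1) \<union> plus_structure ` sphere 0 1"
      using classified
    proof
      assume "\<exists>s\<in>sphere 0 1. J = acs 1 s (-1)"
      then obtain s where s: "s \<in> sphere 0 1" "J = acs 1 s (-1)" by blast
      obtain t where t: "t \<in> sphere 0 1" "quat (-1) t v = J v"
        using transitive[of "-1"] by blast
      then have "v \<in> plane s t"
        using E by (simp add: plane_def s(2) acs_noncentral)
      then have "V = plane s t"
        using plane_eq_span[OF s(1) t(1) _ v(1)] v(2) by (simp add: s(2) acs_plane)
      then have "X = minus_structure (s, t)"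
        by (simp add: pos minus_structure_def s(2))
      then show ?thesis using s(1) t(1) by blast
    next
      assume J: "J = acs (-1) e1 1"
      obtain s where s: "s \<in> sphere 0 1" "quat 1 s v = J v"
        using transitive[of 1] by blast
      then have "v \<in> plane s e1"
        using E by (simp add: plane_def J acs_noncentral)
      then have "V = plane s e1"
        using plane_eq_span[OF s(1) e1 _ v(1)] v(2) by (simp add: J acs_plane)
      then have "X = plus_structure s"
        by (simp add: pos plus_structure_def J)
      then show ?thesis using s(1) by blast
    qed
  }
qed

lemma fundamental_form_acs:
  "fundamental_form (acs \<kappa> s \<epsilon>) = fundamental_form (quat \<kappa> s) + \<epsilon> *\<^sub>R fundamental_form rot56"
  by (simp add: vec_eq_iff fundamental_form_nth acs_def)

lemma linear_quat_form: "linear (\<lambda>s. fundamental_form (quat \<kappa> s))"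
  by (rule linearI) (simp_all add: vec_eq_iff forall_6 fundamental_form_nth quat_nth algebra_simps)

lemma ms_form_minus_structure:
  assumes "s \<in> sphere 0 1" "t \<in> sphere 0 1"
  shows "ms_form \<alpha> (minus_structure (s, t)) = - fundamental_form rot56
    + ((1 + \<alpha>/2) *\<^sub>R fundamental_form (quat 1 s) + (\<alpha>/2) *\<^sub>R fundamental_form (quat (-1) t))"
  unfolding minus_structure_def prod.case
  by (subst ms_form_oriented_by[OF assms])
    (auto simp: acs_plane fundamental_form_acs algebra_simps)

lemma ms_form_plus_structure:
  assumes "s \<in> sphere 0 1"
  shows "ms_form \<alpha> (plus_structure s) = fundamental_form rot56
    + (1 + \<alpha>/2) *\<^sub>R fundamental_form (quat (-1) e1) + (\<alpha>/2) *\<^sub>R fundamental_form (quat 1 s)"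
  unfolding plus_structure_def using assms
  by (subst ms_form_oriented_by)
    (auto simp: acs_plane fundamental_form_acs algebra_simps)

section \<open>The projective line as a round sphere\<close>

text \<open>The Hopf map \<open>(v\<^sub>1, v\<^sub>2) \<mapsto> (\<bar>v\<^sub>1\<bar>\<^sup>2 - \<bar>v\<^sub>2\<bar>\<^sup>2, 2 v\<^sub>1 cnj v\<^sub>2)\<close>, normalised so that it is constant on complex
lines.\<close>

definition hopf_vec :: "complex^2 \<Rightarrow> real^3" where
  "hopf_vec v = (1 / ((cmod (v$1))\<^sup>2 + (cmod (v$2))\<^sup>2)) *\<^sub>R
     vector [(cmod (v$1))\<^sup>2 - (cmod (v$2))\<^sup>2, 2 * Re (v$1 * cnj (v$2)), 2 * Im (v$1 * cnj (v$2))]"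

definition hopf :: "(complex^2) set \<Rightarrow> real^3" where
  "hopf L = hopf_vec (SOME v. v \<in> L \<and> v \<noteq> 0)"

lemma hopf_vec_scale:
  assumes "c \<noteq> 0"
  shows "hopf_vec (c *s v) = hopf_vec v"
proof -
  have r: "(cmod c)\<^sup>2 \<noteq> 0" using assms by simp
  have "vector [(cmod ((c *s v)$1))\<^sup>2 - (cmod ((c *s v)$2))\<^sup>2,
      2 * Re ((c *s v)$1 * cnj ((c *s v)$2)), 2 * Im ((c *s v)$1 * cnj ((c *s v)$2))]
    = (cmod c)\<^sup>2 *\<^sub>R (vector [(cmod (v$1))\<^sup>2 - (cmod (v$2))\<^sup>2, 2 * Re (v$1 * cnj (v$2)),
        2 * Im (v$1 * cnj (v$2))] :: real^3)"
    unfolding cmod_power2 by (simp add: vec_eq_iff forall_3 power2_eq_square algebra_simps)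
  moreover have "(cmod ((c *s v)$1))\<^sup>2 + (cmod ((c *s v)$2))\<^sup>2
      = (cmod c)\<^sup>2 * ((cmod (v$1))\<^sup>2 + (cmod (v$2))\<^sup>2)"
    by (simp add: norm_mult power_mult_distrib distrib_left)
  ultimately show ?thesis
    using r by (simp add: hopf_vec_def)
qed

lemma complex_line_eq:
  assumes "u \<in> complex_line v" "u \<noteq> 0"
  shows "complex_line u = complex_line v"
proof -
  obtain c where c: "u = c *s v" using assms(1) by (auto simp: complex_line_def)
  then have "c \<noteq> 0" using assms(2) by auto
  then have "v = (1/c) *s u"
    by (simp add: c vector_smult_assoc)
  have "d *s v \<in> complex_line u" for d
    unfolding complex_line_def by (subst \<open>v = _\<close>) (metis rangeI vector_smult_assoc)
  moreover have "d *s u \<in> complex_line v" for d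
    unfolding complex_line_def by (metis c rangeI vector_smult_assoc)
  ultimately show ?thesis
    unfolding complex_line_def[of v] complex_line_def[of u]
    by (auto simp: complex_line_def)
qed

lemma mem_complex_line: "v \<in> complex_line v"
  unfolding complex_line_def by (metis rangeI vector_smult_lid)

lemma hopf_complex_line:
  assumes "v \<noteq> 0"
  shows "hopf (complex_line v) = hopf_vec v"
proof -
  let ?u = "SOME u. u \<in> complex_line v \<and> u \<noteq> 0"
  have "?u \<in> complex_line v \<and> ?u \<noteq> 0"
    by (rule someI[of _ v]) (simp add: assms mem_complex_line)
  then obtain c where "?u = c *s v" "c \<noteq> 0"
    by (auto simp: complex_line_def)
  then show ?thesis
    by (simp add: hopf_def hopf_vec_scale)
qed

text \<open>The inverses of the two affine charts.\<close>

definition line1 :: "complex \<Rightarrow> (complex^2) set" where "line1 w = complex_line (vector [1, w])"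
definition line2 :: "complex \<Rightarrow> (complex^2) set" where "line2 w = complex_line (vector [w, 1])"

lemma vector_2_nz: "(vector [1, w] :: complex^2) \<noteq> 0" "(vector [w, 1] :: complex^2) \<noteq> 0"
  by (auto simp: vec_eq_iff forall_2)

lemma mem_line: "vector [1, w'] \<in> line1 w \<longleftrightarrow> w' = w" "vector [w', 1] \<in> line2 w \<longleftrightarrow> w' = w"
  unfolding line1_def line2_def complex_line_def
  by (auto simp: vec_eq_iff forall_2 image_iff intro: exI[of _ 1])

lemma line_in_CP1: "line1 w \<in> CP1" "line2 w \<in> CP1"
  unfolding line1_def line2_def CP1_def using vector_2_nz by blast+

lemma chart_domain:
  "{L \<in> CP1. \<exists>w. vector [1, w] \<in> L} = range line1" "{L \<in> CP1. \<exists>w. vector [w, 1] \<in> L} = range line2"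
proof -
  have "L = line1 w" if "L \<in> CP1" "vector [1, w] \<in> L" for L w
    using that complex_line_eq vector_2_nz by (auto simp: CP1_def line1_def)
  then show "{L \<in> CP1. \<exists>w. vector [1, w] \<in> L} = range line1"
    using mem_line(1) line_in_CP1(1) by blast
  have "L = line2 w" if "L \<in> CP1" "vector [w, 1] \<in> L" for L w
    using that complex_line_eq vector_2_nz by (auto simp: CP1_def line2_def)
  then show "{L \<in> CP1. \<exists>w. vector [w, 1] \<in> L} = range line2"
    using mem_line(2) line_in_CP1(2) by blast
qed

lemma CP1_atlas_eq:
  "CP1_atlas = {(range line1, \<lambda>L. THE w. vector [1, w] \<in> L), (range line2, \<lambda>L. THE w. vector [w, 1] \<in> L)}"
  by (simp only: CP1_atlas_def chart_domain)

lemma CP1_cases: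
  assumes "L \<in> CP1"
  shows "L \<in> range line1 \<or> L = line2 0" "L \<in> range line2 \<or> L = line1 0"
proof -
  obtain v where v: "v \<noteq> 0" "L = complex_line v"
    using assms by (auto simp: CP1_def)
  have 1: "L = line1 (v$2 / v$1)" if "v$1 \<noteq> 0"
  proof -
    have "vector [1, v$2 / v$1] = (1 / v$1) *s v"
      using that by (simp add: vec_eq_iff forall_2)
    then have "vector [1, v$2 / v$1] \<in> complex_line v"
      unfolding complex_line_def by (metis rangeI)
    then show ?thesis
      unfolding v(2) line1_def by (rule complex_line_eq[OF _ vector_2_nz(1), symmetric])
  qed
  have 2: "L = line2 (v$1 / v$2)" if "v$2 \<noteq> 0"
  proof -
    have "vector [v$1 / v$2, 1] = (1 / v$2) *s v"
      using that by (simp add: vec_eq_iff forall_2)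
    then have "vector [v$1 / v$2, 1] \<in> complex_line v"
      unfolding complex_line_def by (metis rangeI)
    then show ?thesis
      unfolding v(2) line2_def by (rule complex_line_eq[OF _ vector_2_nz(2), symmetric])
  qed
  have "v$1 \<noteq> 0 \<or> v$2 \<noteq> 0"
    using v(1) by (auto simp: vec_eq_iff forall_2)
  then show "L \<in> range line1 \<or> L = line2 0"
    using 1 2 by (cases "v$1 = 0") auto
  show "L \<in> range line2 \<or> L = line1 0"
    using 1 2 \<open>v$1 \<noteq> 0 \<or> v$2 \<noteq> 0\<close> by (cases "v$2 = 0") auto
qed

lemma hopf_line1: "hopf (line1 w) = vector
    [(1 - ((Re w)\<^sup>2 + (Im w)\<^sup>2)) / (1 + ((Re w)\<^sup>2 + (Im w)\<^sup>2)),
     2 * Re w / (1 + ((Re w)\<^sup>2 + (Im w)\<^sup>2)), -2 * Im w / (1 + ((Re w)\<^sup>2 + (Im w)\<^sup>2))]"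
  unfolding line1_def hopf_complex_line[OF vector_2_nz(1)]
  by (simp add: hopf_vec_def vec_eq_iff forall_3 cmod_power2)

lemma hopf_line2: "hopf (line2 w) = vector
    [(((Re w)\<^sup>2 + (Im w)\<^sup>2) - 1) / (1 + ((Re w)\<^sup>2 + (Im w)\<^sup>2)),
     2 * Re w / (1 + ((Re w)\<^sup>2 + (Im w)\<^sup>2)), 2 * Im w / (1 + ((Re w)\<^sup>2 + (Im w)\<^sup>2))]"
  unfolding line2_def hopf_complex_line[OF vector_2_nz(2)]
  by (simp add: hopf_vec_def vec_eq_iff forall_3 cmod_power2 add.commute)

text \<open>Stereographic projections from \<open>(-1, 0, 0)\<close> and \<open>(1, 0, 0)\<close>, with the orientation that makes them
the affine coordinates of the projective line; on all of the respective half-space they are smooth.\<close>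

definition stereo1 :: "real^3 \<Rightarrow> complex" where
  "stereo1 s = Complex (s$2 / (1 + s$1)) (- s$3 / (1 + s$1))"
definition stereo2 :: "real^3 \<Rightarrow> complex" where
  "stereo2 s = Complex (s$2 / (1 - s$1)) (s$3 / (1 - s$1))"

lemma one_plus_norm_pos: "1 + ((Re w)\<^sup>2 + (Im w)\<^sup>2) > 0"
  by (rule add_pos_nonneg) simp_all

lemma stereo_hopf: "stereo1 (hopf (line1 w)) = w" "stereo2 (hopf (line2 w)) = w"
proof -
  define n where "n = (Re w)\<^sup>2 + (Im w)\<^sup>2"
  have n: "1 + n > 0" using one_plus_norm_pos[of w] by (simp add: n_def)
  then have "1 + (1 - n) / (1 + n) = 2 / (1 + n)" "1 - (n - 1) / (1 + n) = 2 / (1 + n)"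
    by (simp_all add: field_simps)
  with n show "stereo1 (hopf (line1 w)) = w" "stereo2 (hopf (line2 w)) = w"
    by (simp_all add: stereo1_def stereo2_def hopf_line1 hopf_line2 n_def[symmetric] complex_eq_iff)
qed

lemma hopf_stereo:
  assumes "s \<in> sphere 0 1" "s$1 \<noteq> -1"
  shows "hopf (line1 (stereo1 s)) = s"
proof -
  have s: "(s$1)\<^sup>2 + (s$2)\<^sup>2 + (s$3)\<^sup>2 = 1" using assms(1) by (simp only: sphere_3)
  define d where "d = 1 + s$1"
  have d: "d \<noteq> 0" using assms(2) by (simp add: d_def)
  define n where "n = (Re (stereo1 s))\<^sup>2 + (Im (stereo1 s))\<^sup>2"
  have "n = ((s$2)\<^sup>2 + (s$3)\<^sup>2) / d\<^sup>2"
    by (simp add: n_def stereo1_def d_def power_divide add_divide_distrib)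
  also have "(s$2)\<^sup>2 + (s$3)\<^sup>2 = d * (2 - d)"
    using s by (simp add: d_def power2_eq_square algebra_simps)
  finally have "n = (2 - d) / d"
    using d by (simp add: power2_eq_square)
  then have n: "1 + n = 2 / d" "1 - n = 2 * (d - 1) / d"
    using d by (simp_all add: field_simps)
  show ?thesis
    unfolding hopf_line1 n_def[symmetric] n
    using d by (simp add: vec_eq_iff forall_3 stereo1_def d_def[symmetric]) (simp add: d_def)
qed

lemma hopf_poles: "hopf (line2 0) = vector [-1, 0, 0]" "hopf (line1 0) = vector [1, 0, 0]"
  by (simp_all add: hopf_line1 hopf_line2)

lemma hopf_in_sphere:
  assumes "L \<in> CP1"
  shows "hopf L \<in> sphere 0 1"
proof -
  have "hopf (line1 w) \<in> sphere 0 1" for w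
  proof -
    define n where "n = (Re w)\<^sup>2 + (Im w)\<^sup>2"
    have n: "1 + n > 0" using one_plus_norm_pos[of w] by (simp add: n_def)
    have "((1 - n) / (1 + n))\<^sup>2 + (2 * Re w / (1 + n))\<^sup>2 + (-2 * Im w / (1 + n))\<^sup>2
      = ((1 - n)\<^sup>2 + 4 * n) / (1 + n)\<^sup>2"
      by (simp add: power_divide add_divide_distrib power_mult_distrib n_def)
    also have "(1 - n)\<^sup>2 + 4 * n = (1 + n)\<^sup>2"
      by (simp add: power2_eq_square algebra_simps)
    also have "(1 + n)\<^sup>2 / (1 + n)\<^sup>2 = 1"
      using n by simp
    finally show ?thesis
      by (simp only: sphere_3 hopf_line1 vector_3 n_def)
  qed
  moreover have "hopf (line2 0) \<in> sphere 0 1"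
    by (simp only: sphere_3 hopf_poles vector_3) simp
  ultimately show ?thesis
    using CP1_cases(1)[OF assms] by blast
qed

lemma hopf_bij: "bij_betw hopf CP1 (sphere 0 1)"
  unfolding bij_betw_def
proof
  have south: "hopf (line1 w) $ 1 \<noteq> -1" for w
    using one_plus_norm_pos[of w] by (simp add: hopf_line1 field_simps)
  show "inj_on hopf CP1"
  proof
    have pole: "N = line2 0" if "N \<in> CP1" "hopf N $ 1 = -1" for N
      using CP1_cases(1)[OF that(1)] that(2) south by blast
    have chart: "N \<in> range line1" if "N \<in> CP1" "hopf N $ 1 \<noteq> -1" for N
      using CP1_cases(1)[OF that(1)] that(2) by (auto simp: hopf_poles)
    fix L M assume L: "L \<in> CP1" and M: "M \<in> CP1" and eq: "hopf L = hopf M"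
    show "L = M"
    proof (cases "hopf L $ 1 = -1")
      case True
      then show ?thesis
        using pole[OF L] pole[OF M] eq by simp
    next
      case False
      then have "L \<in> range line1" "M \<in> range line1"
        using chart[OF L] chart[OF M] eq by simp_all
      then show ?thesis
        using eq by (metis rangeE stereo_hopf(1))
    qed
  qed
  show "hopf ` CP1 = sphere 0 1"
  proof
    show "hopf ` CP1 \<subseteq> sphere 0 1" using hopf_in_sphere by blast
    show "sphere 0 1 \<subseteq> hopf ` CP1"
    proof
      fix s :: "real^3" assume s: "s \<in> sphere 0 1"
      show "s \<in> hopf ` CP1"
      proof (cases "s$1 = -1")
        case False
        then show ?thesis using hopf_stereo[OF s] line_in_CP1 by (metis image_eqI)
      next
        case True
        then have "(s$2)\<^sup>2 + (s$3)\<^sup>2 = 0"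
          using s[unfolded sphere_3] by simp
        then have "s = hopf (line2 0)"
          using True by (simp add: sum_power2_eq_zero_iff vec_eq_iff forall_3 hopf_poles)
        then show ?thesis using line_in_CP1 by blast
      qed
    qed
  qed
qed

lemma smooth_stereo:
  "smooth_on {s. s$1 > -1} stereo1" "smooth_on {s. s$1 < 1} stereo2"
proof -
  have o1: "open {s :: real^3. s$1 > -1}" and o2: "open {s :: real^3. s$1 < 1}"
    by (intro open_Collect_less continuous_intros)+
  note nth = smooth_on_bounded_linear[OF _ bounded_linear_vec_nth]
  note neg = smooth_on_linear_compose[OF bounded_linear_minus[OF bounded_linear_ident]]
  have d1: "smooth_on {s :: real^3. s$1 > -1} (\<lambda>s. 1 + s$1)"
    by (rule smooth_on_add[OF o1 smooth_on_const[OF o1] nth[OF o1]])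
  have d2: "smooth_on {s :: real^3. s$1 < 1} (\<lambda>s. 1 - s$1)"
    unfolding diff_conv_add_uminus by (rule smooth_on_add[OF o2 smooth_on_const[OF o2] neg[OF o2 nth[OF o2]]])
  have "smooth_on {s. s$1 > -1} (\<lambda>s :: real^3. Complex (s$2 / (1 + s$1)) (- s$3 / (1 + s$1)))"
    by (rule smooth_on_Complex[OF o1 smooth_on_divide[OF o1 nth[OF o1] d1]
          smooth_on_divide[OF o1 neg[OF o1 nth[OF o1]] d1]]) auto
  then show "smooth_on {s. s$1 > -1} stereo1"
    by (simp add: stereo1_def[abs_def])
  have "smooth_on {s. s$1 < 1} (\<lambda>s :: real^3. Complex (s$2 / (1 - s$1)) (s$3 / (1 - s$1)))"
    by (rule smooth_on_Complex[OF o2 smooth_on_divide[OF o2 nth[OF o2] d2]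
          smooth_on_divide[OF o2 nth[OF o2] d2]]) auto
  then show "smooth_on {s. s$1 < 1} stereo2"
    by (simp add: stereo2_def[abs_def])
qed

lemma smooth_hopf_line: "smooth_on UNIV (\<lambda>w. hopf (line1 w))" "smooth_on UNIV (\<lambda>w. hopf (line2 w))"
proof -
  note O = open_UNIV[where 'a=complex]
  note mult = smooth_on_bilinear[OF bounded_bilinear_mult O]
  note re = smooth_on_bounded_linear[OF O bounded_linear_Re]
    and im = smooth_on_bounded_linear[OF O bounded_linear_Im]
  have n: "smooth_on UNIV (\<lambda>w. (Re w)\<^sup>2 + (Im w)\<^sup>2)"
    unfolding power2_eq_square by (rule smooth_on_add[OF O mult[OF re re] mult[OF im im]])
  have d: "smooth_on UNIV (\<lambda>w. 1 + ((Re w)\<^sup>2 + (Im w)\<^sup>2))"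
    by (rule smooth_on_add[OF O smooth_on_const[OF O] n])
  have a: "smooth_on UNIV (\<lambda>w. c + b * ((Re w)\<^sup>2 + (Im w)\<^sup>2))" for b c
    by (rule smooth_on_add[OF O smooth_on_const[OF O] mult[OF smooth_on_const[OF O] n]])
  have nz: "1 + ((Re w)\<^sup>2 + (Im w)\<^sup>2) \<noteq> 0" for w
    using one_plus_norm_pos[of w] by simp
  note c = mult[OF smooth_on_const[OF O]]
  have main: "smooth_on UNIV (\<lambda>w. vector [(c + b * ((Re w)\<^sup>2 + (Im w)\<^sup>2)) / (1 + ((Re w)\<^sup>2 + (Im w)\<^sup>2)),
     2 * Re w / (1 + ((Re w)\<^sup>2 + (Im w)\<^sup>2)), e * Im w / (1 + ((Re w)\<^sup>2 + (Im w)\<^sup>2))] :: real^3)" for b c e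
    by (rule smooth_on_vector_3[OF O smooth_on_divide[OF O a d] smooth_on_divide[OF O c[OF re] d]
          smooth_on_divide[OF O c[OF im] d]]) (rule nz)+
  show "smooth_on UNIV (\<lambda>w. hopf (line1 w))"
    unfolding hopf_line1 using main[of 1 "-1" "-2"]
    by (simp only: mult_minus1 diff_conv_add_uminus)
  show "smooth_on UNIV (\<lambda>w. hopf (line2 w))"
    unfolding hopf_line2 using main[of "-1" 1 2]
    by (simp only: mult_1_left diff_conv_add_uminus add.commute[of _ "-1"])
qed

lemma chart_image:
  assumes "\<And>w. \<phi> (line w) = w"
  shows "\<phi> ` range line = UNIV" "inj_on \<phi> (range line)" "inv_into (range line) \<phi> w = line w"
proof -
  show "\<phi> ` range line = UNIV"
    by (simp add: image_image assms)
  show inj: "inj_on \<phi> (range line)"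
    by (auto simp: inj_on_def assms)
  show "inv_into (range line) \<phi> w = line w"
    by (rule inv_into_f_eq[OF inj]) (simp_all add: assms)
qed

lemma chart_line: "(THE w. vector [1, w] \<in> line1 w') = w'" "(THE w. vector [w, 1] \<in> line2 w') = w'"
  by (simp_all add: mem_line)

lemma CP1_atlas_charts:
  assumes "(U, \<phi>) \<in> CP1_atlas"
  shows "open (\<phi> ` U) \<and> inj_on \<phi> U"
  using assms chart_image[where line = line1, OF chart_line(1)] chart_image[where line = line2, OF chart_line(2)]
  by (auto simp: CP1_atlas_eq)

lemma hopf_diffeomorphism: "diffeomorphism_onto CP1_atlas hopf (sphere 0 1)"
  unfolding diffeomorphism_onto_def points_CP1_atlas
proof (intro conjI)
  let ?\<phi>1 = "\<lambda>L :: (complex^2) set. THE w. vector [1, w] \<in> L"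
  let ?\<phi>2 = "\<lambda>L :: (complex^2) set. THE w. vector [w, 1] \<in> L"
  note c1 = chart_image[where line = line1 and \<phi> = ?\<phi>1, OF chart_line(1)]
  note c2 = chart_image[where line = line2 and \<phi> = ?\<phi>2, OF chart_line(2)]
  show "bij_betw hopf CP1 (sphere 0 1)" by (rule hopf_bij)
  have "smooth_on (?\<phi>1 ` range line1) (hopf \<circ> inv_into (range line1) ?\<phi>1)"
    unfolding c1(1) comp_def c1(3) by (rule smooth_hopf_line)
  moreover have "smooth_on (?\<phi>2 ` range line2) (hopf \<circ> inv_into (range line2) ?\<phi>2)"
    unfolding c2(1) comp_def c2(3) by (rule smooth_hopf_line)
  ultimately show "\<forall>(U, \<phi>)\<in>CP1_atlas. smooth_on (\<phi> ` U) (hopf \<circ> inv_into U \<phi>)"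
    unfolding CP1_atlas_eq by blast
  have o1: "open {s :: real^3. s$1 > -1}" and o2: "open {s :: real^3. s$1 < 1}"
    by (intro open_Collect_less continuous_intros)+
  have in1: "hopf L $ 1 > -1" if "L \<in> range line1" for L
  proof -
    obtain w where w: "L = line1 w" using \<open>L \<in> range line1\<close> by blast
    show ?thesis using one_plus_norm_pos[of w] by (simp add: w hopf_line1 field_simps)
  qed
  have in2: "hopf L $ 1 < 1" if "L \<in> range line2" for L
  proof -
    obtain w where w: "L = line2 w" using \<open>L \<in> range line2\<close> by blast
    show ?thesis using one_plus_norm_pos[of w] by (simp add: w hopf_line2 field_simps)
  qed
  have back1: "L \<in> range line1 \<and> ?\<phi>1 L = stereo1 (hopf L)" if "L \<in> CP1" "hopf L $ 1 > -1" for L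
    using CP1_cases(1)[OF that(1)] that(2) by (auto simp: hopf_poles chart_line stereo_hopf)
  have back2: "L \<in> range line2 \<and> ?\<phi>2 L = stereo2 (hopf L)" if "L \<in> CP1" "hopf L $ 1 < 1" for L
    using CP1_cases(2)[OF that(1)] that(2) by (auto simp: hopf_poles chart_line stereo_hopf)
  have "\<forall>p\<in>range line1. \<exists>W g. open W \<and> hopf p \<in> W \<and> smooth_on W g \<and>
      (\<forall>q\<in>CP1. hopf q \<in> W \<longrightarrow> q \<in> range line1 \<and> ?\<phi>1 q = g (hopf q))"
    using o1 smooth_stereo(1) in1 back1
    by (intro ballI exI[of _ "{s :: real^3. s$1 > -1}"] exI[of _ stereo1]) blast
  moreover have "\<forall>p\<in>range line2. \<exists>W g. open W \<and> hopf p \<in> W \<and> smooth_on W g \<and>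
      (\<forall>q\<in>CP1. hopf q \<in> W \<longrightarrow> q \<in> range line2 \<and> ?\<phi>2 q = g (hopf q))"
    using o2 smooth_stereo(2) in2 back2
    by (intro ballI exI[of _ "{s :: real^3. s$1 < 1}"] exI[of _ stereo2]) blast
  ultimately show "\<forall>(U, \<phi>)\<in>CP1_atlas. \<forall>p\<in>U. \<exists>W g. open W \<and> hopf p \<in> W \<and> smooth_on W g \<and>
      (\<forall>q\<in>CP1. hopf q \<in> W \<longrightarrow> q \<in> U \<and> \<phi> q = g (hopf q))"
    unfolding CP1_atlas_eq by blast
qed

section \<open>Images under the moment map\<close>

lemma sphere_first_coordinate: "(\<lambda>s :: real^3. s$1) ` sphere 0 1 = {-1..1}"
proof
  show "(\<lambda>s :: real^3. s$1) ` sphere 0 1 \<subseteq> {-1..1}"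
  proof
    fix x assume "x \<in> (\<lambda>s :: real^3. s$1) ` sphere 0 1"
    then obtain s :: "real^3" where "norm s = 1" "x = s$1" by auto
    then show "x \<in> {-1..1}"
      using component_le_norm_cart[of s 1] by (simp add: abs_le_iff)
  qed
  show "{-1..1} \<subseteq> (\<lambda>s :: real^3. s$1) ` sphere 0 1"
  proof
    fix x :: real assume "x \<in> {-1..1}"
    then have "x\<^sup>2 \<le> 1" by (simp add: abs_square_le_1 abs_le_iff)
    then have "vector [x, sqrt (1 - x\<^sup>2), 0] \<in> sphere (0 :: real^3) 1"
      by (simp only: sphere_3 vector_3) simp
    then show "x \<in> (\<lambda>s :: real^3. s$1) ` sphere 0 1"
      by (rule rev_image_eqI) simp
  qed
qed

lemma ends_hull: "convex hull {-1, 1 :: real} = {-1..1}"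
  by (simp add: segment_convex_hull[symmetric] closed_segment_eq_real_ivl)

text \<open>The square is the convex hull of its corners, and affine maps commute with convex hulls.\<close>

lemma affine_square_image:
  fixes c p q :: "'a::real_vector"
  shows "(\<lambda>(x, y). c + (x *\<^sub>R p + y *\<^sub>R q)) ` ({-1..1} \<times> {-1..1})
    = convex hull {c + (p + q), c + (p - q), c + (q - p), c + (- p - q)}"
proof -
  let ?L = "\<lambda>(x, y). x *\<^sub>R p + y *\<^sub>R q"
  have L: "linear ?L"
    by (rule linearI) (auto simp: algebra_simps)
  have "(\<lambda>(x, y). c + (x *\<^sub>R p + y *\<^sub>R q)) ` ({-1..1} \<times> {-1..1})
      = (+) c ` ?L ` (convex hull ({-1, 1} \<times> {-1, 1}))"
    unfolding convex_hull_Times ends_hull image_image by (simp add: case_prod_beta)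
  also have "\<dots> = convex hull ((+) c ` ?L ` ({-1, 1} \<times> {-1, 1}))"
    by (simp only: convex_hull_linear_image[OF L] convex_hull_translation)
  also have "(+) c ` ?L ` ({-1, 1} \<times> {-1, 1}) = {c + (p + q), c + (p - q), c + (q - p), c + (- p - q)}"
    by (auto simp: image_iff)
  finally show ?thesis .
qed

lemma affine_interval_image:
  fixes c p :: "'a::real_vector"
  shows "(\<lambda>x. c + x *\<^sub>R p) ` {-1..1} = closed_segment (c + p) (c - p)"
proof -
  have L: "linear (\<lambda>x. x *\<^sub>R p)"
    by (rule linearI) (auto simp: algebra_simps)
  have "(\<lambda>x. c + x *\<^sub>R p) ` {-1..1} = (+) c ` (\<lambda>x. x *\<^sub>R p) ` (convex hull {-1, 1})"
    by (simp add: ends_hull image_image)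
  also have "\<dots> = convex hull ((+) c ` (\<lambda>x. x *\<^sub>R p) ` {-1, 1})"
    by (simp only: convex_hull_linear_image[OF L] convex_hull_translation)
  also have "(+) c ` (\<lambda>x. x *\<^sub>R p) ` {-1, 1} = {c + p, c - p}"
    by auto
  finally show ?thesis by (simp add: segment_convex_hull)
qed

lemma moment_map_ms_form_minus:
  assumes "s \<in> sphere 0 1" "t \<in> sphere 0 1"
  shows "moment_map (ms_form \<alpha> (minus_structure (s, t))) = vector [0, 0, -1]
    + (s$1 *\<^sub>R vector [1 + \<alpha>/2, - 1 - \<alpha>/2, 0] + t$1 *\<^sub>R vector [\<alpha>/2, \<alpha>/2, 0])"
  by (simp add: ms_form_minus_structure[OF assms] moment_map_def vec_eq_iff forall_3
      fundamental_form_nth quat_nth rot56_nth axis_def algebra_simps)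

lemma moment_map_ms_form_plus:
  assumes "s \<in> sphere 0 1"
  shows "moment_map (ms_form \<alpha> (plus_structure s)) = vector [1 + \<alpha>/2, 1 + \<alpha>/2, 1]
    + s$1 *\<^sub>R vector [\<alpha>/2, - \<alpha>/2, 0]"
  by (simp add: ms_form_plus_structure[OF assms] moment_map_def vec_eq_iff forall_3
      fundamental_form_nth quat_nth rot56_nth axis_def algebra_simps)

text \<open>The second coordinates of \<open>I\<^sub>s\<close> and \<open>B\<^sub>t\<close> under the moment map are \<open>- s\<^sub>1\<close> and \<open>t\<^sub>1\<close>; so the edges of
the rectangle point along \<open>(1, -1, 0)\<close> and \<open>(1, 1, 0)\<close>.\<close>

lemma moment_image_minus:
  "(\<lambda>p. moment_map (ms_form \<alpha> (minus_structure p))) ` (sphere 0 1 \<times> sphere 0 1) =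
     convex hull {vector [1 + \<alpha>, -1, -1], vector [1, -1 - \<alpha>, -1],
                  vector [-1 - \<alpha>, 1, -1], vector [-1, 1 + \<alpha>, -1]}"
proof -
  let ?c = "vector [0, 0, -1] :: real^3" and ?p = "vector [1 + \<alpha>/2, - 1 - \<alpha>/2, 0] :: real^3"
  let ?q = "vector [\<alpha>/2, \<alpha>/2, 0] :: real^3"
  let ?A = "\<lambda>(x, y). ?c + (x *\<^sub>R ?p + y *\<^sub>R ?q)"
  have "(\<lambda>p. moment_map (ms_form \<alpha> (minus_structure p))) ` (sphere 0 1 \<times> sphere 0 1)
      = (\<lambda>p. ?A (map_prod (\<lambda>s :: real^3. s$1) (\<lambda>s :: real^3. s$1) p)) ` (sphere 0 1 \<times> sphere 0 1)"
    by (rule image_cong) (auto simp: moment_map_ms_form_minus)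
  also have "\<dots> = ?A ` (((\<lambda>s :: real^3. s$1) ` sphere 0 1) \<times> ((\<lambda>s :: real^3. s$1) ` sphere 0 1))"
    by (simp only: image_image[symmetric] map_prod_surj_on[OF refl refl])
  also have "\<dots> = convex hull {?c + (?p + ?q), ?c + (?p - ?q), ?c + (?q - ?p), ?c + (- ?p - ?q)}"
    unfolding sphere_first_coordinate by (rule affine_square_image)
  also have "{?c + (?p + ?q), ?c + (?p - ?q), ?c + (?q - ?p), ?c + (- ?p - ?q)} =
     {vector [1 + \<alpha>, -1, -1], vector [1, -1 - \<alpha>, -1],
      vector [-1, 1 + \<alpha>, -1], vector [-1 - \<alpha>, 1, -1]}"
  proof -
    have "?c + (?p + ?q) = vector [1 + \<alpha>, -1, -1]" "?c + (?p - ?q) = vector [1, -1 - \<alpha>, -1]"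
      "?c + (?q - ?p) = vector [-1, 1 + \<alpha>, -1]" "?c + (- ?p - ?q) = vector [-1 - \<alpha>, 1, -1]"
      by (simp_all add: vec_eq_iff forall_3)
    then show ?thesis by (simp only:)
  qed
  finally show ?thesis by (simp only: insert_commute)
qed

lemma moment_image_plus:
  "(\<lambda>s. moment_map (ms_form \<alpha> (plus_structure s))) ` sphere 0 1 =
     closed_segment (vector [1 + \<alpha>, 1, 1]) (vector [1, 1 + \<alpha>, 1])"
proof -
  let ?c = "vector [1 + \<alpha>/2, 1 + \<alpha>/2, 1] :: real^3" and ?p = "vector [\<alpha>/2, - \<alpha>/2, 0] :: real^3"
  have "(\<lambda>s. moment_map (ms_form \<alpha> (plus_structure s))) ` sphere 0 1
      = (\<lambda>x. ?c + x *\<^sub>R ?p) ` (\<lambda>s :: real^3. s$1) ` sphere 0 1"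
    unfolding image_image by (rule image_cong) (auto simp: moment_map_ms_form_plus)
  also have "\<dots> = closed_segment (?c + ?p) (?c - ?p)"
    unfolding sphere_first_coordinate by (rule affine_interval_image)
  also have "?c + ?p = vector [1 + \<alpha>, 1, 1]"
    by (simp add: vec_eq_iff forall_3)
  also have "?c - ?p = vector [1, 1 + \<alpha>, 1]"
    by (simp add: vec_eq_iff forall_3)
  finally show ?thesis .
qed

section \<open>The two components\<close>

text \<open>Reads the parameter \<open>s\<close> off the form of \<open>quat \<kappa> s\<close>, ignoring the opposite duality and \<open>e\<^sup>5\<^sup>6\<close>.\<close>

definition quat_part :: "real \<Rightarrow> real^6^6 \<Rightarrow> real^3" where
  "quat_part \<kappa> \<sigma> = (1/2) *\<^sub>R
     vector [\<sigma>$1$2 - \<kappa> * \<sigma>$3$4, \<sigma>$1$3 + \<kappa> * \<sigma>$2$4, \<sigma>$1$4 - \<kappa> * \<sigma>$2$3]"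

lemma linear_quat_part: "linear (quat_part \<kappa>)"
  by (rule linearI) (simp_all add: quat_part_def vec_eq_iff forall_3 algebra_simps)

lemma quat_part_form:
  "quat_part 1 (fundamental_form (quat 1 s)) = s"
  "quat_part (-1) (fundamental_form (quat (-1) s)) = s"
  "quat_part 1 (fundamental_form (quat (-1) s)) = 0"
  "quat_part (-1) (fundamental_form (quat 1 s)) = 0"
  "quat_part \<kappa> (fundamental_form rot56) = 0"
  by (simp_all add: quat_part_def vec_eq_iff forall_3 fundamental_form_nth quat_nth rot56_nth axis_def)

text \<open>The values of \<open>ms_form\<close> on the two families are extended from the spheres to their ambient spaces
as the affine maps \<open>minus_form\<close> and \<open>plus_form\<close>.\<close>

definition minus_form :: "real \<Rightarrow> (real^3) \<times> (real^3) \<Rightarrow> real^6^6" where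
  "minus_form \<alpha> = (\<lambda>p. - fundamental_form rot56 + ((1 + \<alpha>/2) *\<^sub>R fundamental_form (quat 1 (fst p))
     + (\<alpha>/2) *\<^sub>R fundamental_form (quat (-1) (snd p))))"

definition plus_form :: "real \<Rightarrow> real^3 \<Rightarrow> real^6^6" where
  "plus_form \<alpha> = (\<lambda>s. (fundamental_form rot56 + (1 + \<alpha>/2) *\<^sub>R fundamental_form (quat (-1) e1))
     + (\<alpha>/2) *\<^sub>R fundamental_form (quat 1 s))"

lemma product_charts:
  assumes "(U, \<phi>) \<in> product_atlas CP1_atlas CP1_atlas"
  shows "open (\<phi> ` U)"
proof -
  obtain V \<psi> V' \<psi>' where "(V, \<psi>) \<in> CP1_atlas" "(V', \<psi>') \<in> CP1_atlas"
    and U: "U = V \<times> V'" "\<phi> = map_prod \<psi> \<psi>'"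
    using assms by (auto simp: product_atlas_def)
  then have "open (\<psi> ` V \<times> \<psi>' ` V')"
    using CP1_atlas_charts by (intro open_Times) blast+
  then show ?thesis
    by (simp add: U map_prod_surj_on[OF refl refl])
qed

lemma minus_form_diffeomorphism:
  assumes "\<alpha> > 0"
  shows "diffeomorphism_onto (product_atlas CP1_atlas CP1_atlas) (minus_form \<alpha> \<circ> map_prod hopf hopf)
     (minus_form \<alpha> ` (sphere 0 1 \<times> sphere 0 1))"
  unfolding minus_form_def
proof (rule diffeomorphism_onto_affine_image[where R = "\<lambda>\<sigma>. ((1 / (1 + \<alpha>/2)) *\<^sub>R quat_part 1 \<sigma>,
    (1 / (\<alpha>/2)) *\<^sub>R quat_part (-1) \<sigma>)"])
  show "diffeomorphism_onto (product_atlas CP1_atlas CP1_atlas) (map_prod hopf hopf)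
      (sphere 0 1 \<times> sphere 0 1)"
    by (intro diffeomorphism_onto_product hopf_diffeomorphism CP1_atlas_charts)
  show "linear (\<lambda>p. (1 + \<alpha>/2) *\<^sub>R fundamental_form (quat 1 (fst p))
     + (\<alpha>/2) *\<^sub>R fundamental_form (quat (-1) (snd p)))"
    by (rule linearI) (simp_all add: linear_add[OF linear_quat_form] linear_scale[OF linear_quat_form]
       algebra_simps)
  show "linear (\<lambda>\<sigma>. ((1 / (1 + \<alpha>/2)) *\<^sub>R quat_part 1 \<sigma>, (1 / (\<alpha>/2)) *\<^sub>R quat_part (-1) \<sigma>))"
    by (rule linearI) (simp_all add: linear_add[OF linear_quat_part] linear_scale[OF linear_quat_part]
       scaleR_add_right mult.commute)
  have *: "1 + \<alpha>/2 \<noteq> 0" "\<alpha>/2 \<noteq> 0" using assms by auto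
  fix p :: "(real^3) \<times> (real^3)"
  have "quat_part 1 (- fundamental_form rot56 + ((1 + \<alpha>/2) *\<^sub>R fundamental_form (quat 1 (fst p))
     + (\<alpha>/2) *\<^sub>R fundamental_form (quat (-1) (snd p)))) = (1 + \<alpha>/2) *\<^sub>R fst p"
   "quat_part (-1) (- fundamental_form rot56 + ((1 + \<alpha>/2) *\<^sub>R fundamental_form (quat 1 (fst p))
     + (\<alpha>/2) *\<^sub>R fundamental_form (quat (-1) (snd p)))) = (\<alpha>/2) *\<^sub>R snd p"
    by (simp_all only: linear_add[OF linear_quat_part] linear_scale[OF linear_quat_part]
        linear_neg[OF linear_quat_part] quat_part_form) simp_all
  with * show "((1 / (1 + \<alpha>/2)) *\<^sub>R quat_part 1 (- fundamental_form rot56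
     + ((1 + \<alpha>/2) *\<^sub>R fundamental_form (quat 1 (fst p)) + (\<alpha>/2) *\<^sub>R fundamental_form (quat (-1) (snd p)))),
    (1 / (\<alpha>/2)) *\<^sub>R quat_part (-1) (- fundamental_form rot56
     + ((1 + \<alpha>/2) *\<^sub>R fundamental_form (quat 1 (fst p)) + (\<alpha>/2) *\<^sub>R fundamental_form (quat (-1) (snd p))))) = p"
    by (simp only: scaleR_scaleR) simp
qed (rule product_charts)

lemma plus_form_diffeomorphism:
  assumes "\<alpha> > 0"
  shows "diffeomorphism_onto CP1_atlas (plus_form \<alpha> \<circ> hopf) (plus_form \<alpha> ` sphere 0 1)"
  unfolding plus_form_def
proof (rule diffeomorphism_onto_affine_image[where R = "\<lambda>\<sigma>. (1 / (\<alpha>/2)) *\<^sub>R quat_part 1 \<sigma>"])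
  show "linear (\<lambda>s. (\<alpha>/2) *\<^sub>R fundamental_form (quat 1 s))"
    by (intro linear_compose_scale_right linear_quat_form)
  show "linear (\<lambda>\<sigma>. (1 / (\<alpha>/2)) *\<^sub>R quat_part 1 \<sigma>)"
    by (intro linear_compose_scale_right linear_quat_part)
  show "(1 / (\<alpha>/2)) *\<^sub>R quat_part 1 ((fundamental_form rot56
      + (1 + \<alpha>/2) *\<^sub>R fundamental_form (quat (-1) e1)) + (\<alpha>/2) *\<^sub>R fundamental_form (quat 1 s)) = s" for s
    using assms by (simp add: linear_add[OF linear_quat_part] linear_scale[OF linear_quat_part] quat_part_form)
qed (use hopf_diffeomorphism CP1_atlas_charts in auto)

lemma form_56: "minus_form \<alpha> p $ 5 $ 6 = -1" "plus_form \<alpha> s $ 5 $ 6 = 1"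
  by (simp_all add: minus_form_def plus_form_def fundamental_form_nth quat_nth rot56_nth axis_def)

theorem corollary33:
  fixes \<alpha> :: real
  assumes "\<alpha> > 0"
  shows "\<exists>f :: ((complex^2) set \<times> (complex^2) set) + (complex^2) set \<Rightarrow> mixed_structure.
     bij_betw f ((CP1 \<times> CP1) <+> CP1) W34_V15_structures \<and>
     sum_diffeomorphism_onto (product_atlas CP1_atlas CP1_atlas) CP1_atlas
       (ms_form \<alpha> \<circ> f) (ms_form \<alpha> ` W34_V15_structures) \<and>
     (moment_map \<circ> ms_form \<alpha> \<circ> f) ` Inl ` (CP1 \<times> CP1) =
       convex hull {vector [1 + \<alpha>, -1, -1], vector [1, -1 - \<alpha>, -1],
                    vector [-1 - \<alpha>, 1, -1], vector [-1, 1 + \<alpha>, -1]} \<and>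
     (moment_map \<circ> ms_form \<alpha> \<circ> f) ` Inr ` CP1 =
       closed_segment (vector [1 + \<alpha>, 1, 1]) (vector [1, 1 + \<alpha>, 1]) \<and>
     (moment_map \<circ> ms_form \<alpha>) ` W34_V15_structures =
       convex hull {vector [1 + \<alpha>, -1, -1], vector [1, -1 - \<alpha>, -1],
                    vector [-1 - \<alpha>, 1, -1], vector [-1, 1 + \<alpha>, -1]} \<union>
       closed_segment (vector [1 + \<alpha>, 1, 1]) (vector [1, 1 + \<alpha>, 1])"
proof -
  let ?S = "sphere (0 :: real^3) 1"
  define f where "f = case_sum (\<lambda>x. minus_structure (map_prod hopf hopf x)) (\<lambda>L. plus_structure (hopf L))"
  define F where "F = ms_form \<alpha> \<circ> f"
  let ?D = "(CP1 \<times> CP1) <+> CP1"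
  have hopf_image: "hopf ` CP1 = ?S"
    using hopf_bij by (simp add: bij_betw_def)
  then have hopf2_image: "map_prod hopf hopf ` (CP1 \<times> CP1) = ?S \<times> ?S"
    by (rule map_prod_surj_on) (rule hopf_image)
  have minus: "ms_form \<alpha> (minus_structure p) = minus_form \<alpha> p" if "p \<in> ?S \<times> ?S" for p
    using that ms_form_minus_structure by (auto simp: minus_form_def)
  have plus: "ms_form \<alpha> (plus_structure s) = plus_form \<alpha> s" if "s \<in> ?S" for s
    using ms_form_plus_structure[OF that] by (simp add: plus_form_def)
  have F_Inl: "minus_form \<alpha> (map_prod hopf hopf x) = F (Inl x)" if "x \<in> CP1 \<times> CP1" for x
  proof -
    have "map_prod hopf hopf x \<in> ?S \<times> ?S" using that hopf2_image by blast
    from minus[OF this] show ?thesis by (simp add: F_def f_def)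
  qed
  have F_Inr: "plus_form \<alpha> (hopf L) = F (Inr L)" if "L \<in> CP1" for L
  proof -
    have "hopf L \<in> ?S" using that hopf_image by blast
    from plus[OF this] show ?thesis by (simp add: F_def f_def)
  qed
  have f_Inl: "f ` Inl ` (CP1 \<times> CP1) = minus_structure ` (?S \<times> ?S)"
    by (simp only: hopf2_image[symmetric] image_image f_def sum.case)
  have f_Inr: "f ` Inr ` CP1 = plus_structure ` ?S"
    by (simp only: hopf_image[symmetric] image_image f_def sum.case)
  have f_image: "f ` ?D = W34_V15_structures"
    by (simp only: Plus_def image_Un f_Inl f_Inr W34_V15_structures_eq)
  have F_image: "F ` ?D = ms_form \<alpha> ` W34_V15_structures"
    unfolding F_def f_image[symmetric] by (simp only: image_comp)
  have F_Inl_image: "F ` Inl ` (CP1 \<times> CP1) = minus_form \<alpha> ` (?S \<times> ?S)"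
    unfolding hopf2_image[symmetric] image_image using F_Inl by (intro image_cong) simp_all
  have F_Inr_image: "F ` Inr ` CP1 = plus_form \<alpha> ` ?S"
    unfolding hopf_image[symmetric] image_image using F_Inr by (intro image_cong) simp_all
  have diff_Inl: "diffeomorphism_onto (product_atlas CP1_atlas CP1_atlas) (F \<circ> Inl) (F ` Inl ` (CP1 \<times> CP1))"
    unfolding F_Inl_image
    by (rule diffeomorphism_onto_cong[OF minus_form_diffeomorphism[OF assms] product_charts])
      (simp_all add: points_product_atlas points_CP1_atlas F_Inl)
  have diff_Inr: "diffeomorphism_onto CP1_atlas (F \<circ> Inr) (F ` Inr ` CP1)"
    unfolding F_Inr_image
    by (rule diffeomorphism_onto_cong[OF plus_form_diffeomorphism[OF assms]])
      (simp_all add: points_CP1_atlas F_Inr CP1_atlas_charts)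
  have neg: "F x $ 5 $ 6 = -1" if x: "x \<in> Inl ` (CP1 \<times> CP1)" for x
  proof -
    obtain y where "y \<in> CP1 \<times> CP1" "x = Inl y" using x by blast
    then show ?thesis using form_56(1) by (simp only: F_Inl[symmetric])
  qed
  have pos: "F x $ 5 $ 6 = 1" if x: "x \<in> Inr ` CP1" for x
  proof -
    obtain L where "L \<in> CP1" "x = Inr L" using x by blast
    then show ?thesis using form_56(2) by (simp only: F_Inr[symmetric])
  qed
  have "inj_on F ?D"
    unfolding Plus_def
  proof (rule inj_on_Un[THEN iffD2], intro conjI)
    show "inj_on F (Inl ` (CP1 \<times> CP1))"
      using diffeomorphism_onto_inj[OF diff_Inl]
      unfolding points_product_atlas points_CP1_atlas by (rule inj_on_imageI)
    show "inj_on F (Inr ` CP1)"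
      using diffeomorphism_onto_inj[OF diff_Inr]
      unfolding points_CP1_atlas by (rule inj_on_imageI)
    show "F ` (Inl ` (CP1 \<times> CP1) - Inr ` CP1) \<inter> F ` (Inr ` CP1 - Inl ` (CP1 \<times> CP1)) = {}"
    proof (rule ccontr)
      assume "\<not> ?thesis"
      then obtain x y where "x \<in> Inl ` (CP1 \<times> CP1)" "y \<in> Inr ` CP1" "F x = F y" by blast
      then show False using neg[of x] pos[of y] by simp
    qed
  qed
  then have F_bij: "bij_betw F ?D (ms_form \<alpha> ` W34_V15_structures)"
    by (simp add: bij_betw_def F_image)
  have f_bij: "bij_betw f ?D W34_V15_structures"
    unfolding bij_betw_def
  proof
    show "inj_on f ?D"
      using \<open>inj_on F ?D\<close> unfolding F_def by (rule inj_on_imageI2)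
  qed (rule f_image)
  have parts: "ms_form \<alpha> ` W34_V15_structures = F ` Inl ` (CP1 \<times> CP1) \<union> F ` Inr ` CP1"
    by (simp only: F_image[symmetric] Plus_def image_Un)
  have "open {\<sigma> :: real^6^6. \<sigma> $ 5 $ 6 < 0}" "open {\<sigma> :: real^6^6. \<sigma> $ 5 $ 6 > 0}"
    by (auto intro!: open_Collect_less continuous_intros)
  moreover have split: "A = (A \<union> B) \<inter> {\<sigma>. \<sigma> $ 5 $ 6 < 0}" "B = (A \<union> B) \<inter> {\<sigma>. \<sigma> $ 5 $ 6 > 0}"
    if "\<And>\<sigma>. \<sigma> \<in> A \<Longrightarrow> \<sigma> $ 5 $ 6 = -1" "\<And>\<sigma>. \<sigma> \<in> B \<Longrightarrow> \<sigma> $ 5 $ 6 = 1" for A B :: "(real^6^6) set"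
    using that by force+
  have "F ` Inl ` (CP1 \<times> CP1) = ms_form \<alpha> ` W34_V15_structures \<inter> {\<sigma>. \<sigma> $ 5 $ 6 < 0}"
    "F ` Inr ` CP1 = ms_form \<alpha> ` W34_V15_structures \<inter> {\<sigma>. \<sigma> $ 5 $ 6 > 0}"
    unfolding parts by (rule split; use neg pos in blast)+
  ultimately have open_parts: "openin (top_of_set (ms_form \<alpha> ` W34_V15_structures)) (F ` Inl ` (CP1 \<times> CP1))"
    "openin (top_of_set (ms_form \<alpha> ` W34_V15_structures)) (F ` Inr ` CP1)"
    by (simp_all add: openin_open_Int)
  have "sum_diffeomorphism_onto (product_atlas CP1_atlas CP1_atlas) CP1_atlas F
      (ms_form \<alpha> ` W34_V15_structures)"
    unfolding sum_diffeomorphism_onto_def points_product_atlas points_CP1_atlas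
    using F_bij open_parts diff_Inl diff_Inr by blast
  moreover have moment_Inl: "(moment_map \<circ> ms_form \<alpha> \<circ> f) ` Inl ` (CP1 \<times> CP1) =
      (\<lambda>p. moment_map (ms_form \<alpha> (minus_structure p))) ` (?S \<times> ?S)"
    by (simp only: image_comp[symmetric] f_Inl) (simp only: image_image comp_def)
  moreover have moment_Inr: "(moment_map \<circ> ms_form \<alpha> \<circ> f) ` Inr ` CP1 =
      (\<lambda>s. moment_map (ms_form \<alpha> (plus_structure s))) ` ?S"
    by (simp only: image_comp[symmetric] f_Inr) (simp only: image_image comp_def)
  moreover have "(moment_map \<circ> ms_form \<alpha>) ` W34_V15_structures =
      (\<lambda>p. moment_map (ms_form \<alpha> (minus_structure p))) ` (?S \<times> ?S) \<union>
      (\<lambda>s. moment_map (ms_form \<alpha> (plus_structure s))) ` ?S"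
    by (simp only: W34_V15_structures_eq image_Un image_image comp_def)
  ultimately show ?thesis
    using f_bij unfolding moment_image_minus moment_image_plus F_def by blast
qed

end
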